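(* Let $d\ge 1$ and let $b$ be a contractive multiplier of the Drury-Arveson space $H^2_d$. Then $b$ is quasi-extreme if and only if the only multiplier $a\in\mathcal{M}(H^2_d)$ satisfying the operator inequality $$M_a^*M_a+M_b^*M_b\le I$$ on $H^2_d$ is $a\equiv 0$.
   Context: $\mathbb{B}^d$ is the open unit ball of $\mathbb{C}^d$; for $z,w\in\mathbb{C}^d$ write $zw^*=\sum_{j=1}^d z_j\overline{w_j}$; for a scalar, $*$ means complex conjugation. The Drury-Arveson space $H^2_d$ is the reproducing kernel Hilbert space of holomorphic functions on $\mathbb{B}^d$ with kernel $k(z,w)=\frac{1}{1-zw^*}$. A multiplier is a holomorphic function $b$ on $\mathbb{B}^d$ with $bf\in H^2_d$ for all $f\in H^2_d$; then $M_b:f\mapsto bf$ is a bounded operator on $H^2_d$. $\mathcal{M}(H^2_d)$ is the Banach algebra of multipliers with norm $\|M_b\|$. The multiplier $b$ is contractive if $\|M_b\|\le 1$. For a contractive multiplier $b$, $\mathcal{H}(b)$ is the reproducing kernel Hilbert space on $\mathbb{B}^d$ with kernel $k^b(z,w)=\frac{1-b(z)b(w)^*}{1-zw^*}$, and its norm is $\|\cdot\|_b$. A tuple $(b_1,\dots,b_d)$ of functions in $\mathcal{H}(b)$ is called admissible if (i) $\sum_{j=1}^d z_jb_j(z)=b(z)-b(0)$ for all $z\in\mathbb{B}^d$, and (ii) $\sum_{j=1}^d\|b_j\|_b^2\le 1-|b(0)|^2$. The contractive multiplier $b$ is quasi-extreme if every admissible tuple satisfies the equality $\sum_{j=1}^d\|b_j\|_b^2=1-|b(0)|^2$;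 equivalently, $b$ is not quasi-extreme if and only if there is an admissible tuple with $\sum_{j=1}^d\|b_j\|_b^2<1-|b(0)|^2$. *)

theory Defs
  imports "HOL-Analysis.Analysis"
begin

text \<open>
  A Hilbert space of complex-valued functions on a set \<open>X\<close> is given by its set of members and its
  inner product. HOL functions are total, so members are required to vanish outside \<open>X\<close>; this makes
  them correspond one-to-one to functions on \<open>X\<close>. The inner product is only constrained on members;
  it is linear in the first argument.
\<close>

record 'x fspace =
  funs :: "('x \<Rightarrow> complex) set"
  ip :: "('x \<Rightarrow> complex) \<Rightarrow> ('x \<Rightarrow> complex) \<Rightarrow> complex"

definition fnorm :: "'x fspace \<Rightarrow> ('x \<Rightarrow> complex) \<Rightarrow> real" where
  "fnorm H f = sqrt (Re (ip H f f))"

definition inner_product_fspace :: "'x set \<Rightarrow> 'x fspace \<Rightarrow> bool" where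
  "inner_product_fspace X H \<longleftrightarrow>
     (\<forall>f\<in>funs H. \<forall>x. x \<notin> X \<longrightarrow> f x = 0) \<and>
     (\<lambda>x. 0) \<in> funs H \<and>
     (\<forall>f\<in>funs H. \<forall>g\<in>funs H. \<forall>c. (\<lambda>x. c * f x + g x) \<in> funs H) \<and>
     (\<forall>f\<in>funs H. \<forall>g\<in>funs H. \<forall>h\<in>funs H. \<forall>c.
        ip H (\<lambda>x. c * f x + g x) h = c * ip H f h + ip H g h) \<and>
     (\<forall>f\<in>funs H. \<forall>g\<in>funs H. ip H g f = cnj (ip H f g)) \<and>
     (\<forall>f\<in>funs H. ip H f f \<in> \<real>\<^sub>\<ge>\<^sub>0) \<and>
     (\<forall>f\<in>funs H. ip H f f = 0 \<longrightarrow> f = (\<lambda>x. 0))"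

definition complete_fspace :: "'x fspace \<Rightarrow> bool" where
  "complete_fspace H \<longleftrightarrow>
     (\<forall>F :: nat \<Rightarrow> 'x \<Rightarrow> complex.
        (\<forall>n. F n \<in> funs H) \<and>
        (\<forall>e>0. \<exists>N. \<forall>m\<ge>N. \<forall>n\<ge>N. fnorm H (\<lambda>x. F m x - F n x) < e) \<longrightarrow>
        (\<exists>f\<in>funs H. (\<lambda>n. fnorm H (\<lambda>x. F n x - f x)) \<longlonglongrightarrow> 0))"

definition kernel_at :: "'x set \<Rightarrow> ('x \<Rightarrow> 'x \<Rightarrow> complex) \<Rightarrow> 'x \<Rightarrow> 'x \<Rightarrow> complex" where
  "kernel_at X k w = (\<lambda>z. if z \<in> X then k z w else 0)"

text \<open>
  By the Moore--Aronszajn theorem, for a positive kernel \<open>k\<close> on \<open>X\<close> there is exactly one space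
  satisfying the following predicate, up to the values of \<open>ip\<close> on non-members.
\<close>

definition is_rkhs :: "'x set \<Rightarrow> ('x \<Rightarrow> 'x \<Rightarrow> complex) \<Rightarrow> 'x fspace \<Rightarrow> bool" where
  "is_rkhs X k H \<longleftrightarrow>
     inner_product_fspace X H \<and> complete_fspace H \<and>
     (\<forall>w\<in>X. kernel_at X k w \<in> funs H) \<and>
     (\<forall>w\<in>X. \<forall>f\<in>funs H. f w = ip H f (kernel_at X k w))"

text \<open>The operator norm is extended-real-valued, so that it is \<open>\<infinity>\<close> for unbounded operators.\<close>

definition op_norm ::
  "'x fspace \<Rightarrow> (('x \<Rightarrow> complex) \<Rightarrow> ('x \<Rightarrow> complex)) \<Rightarrow> ereal" where
  "op_norm H T = (SUP f\<in>{f \<in> funs H. fnorm H f \<le> 1}. ereal (fnorm H (T f)))"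

text \<open>
  The description is proper on members \<open>g\<close> of a Hilbert space whenever \<open>T\<close> is a bounded operator on it.
\<close>

definition adj ::
  "'x fspace \<Rightarrow> (('x \<Rightarrow> complex) \<Rightarrow> ('x \<Rightarrow> complex)) \<Rightarrow> ('x \<Rightarrow> complex) \<Rightarrow> ('x \<Rightarrow> complex)" where
  "adj H T g = (THE h. h \<in> funs H \<and> (\<forall>f\<in>funs H. ip H (T f) g = ip H f h))"

definition op_le ::
  "'x fspace \<Rightarrow> (('x \<Rightarrow> complex) \<Rightarrow> ('x \<Rightarrow> complex)) \<Rightarrow> (('x \<Rightarrow> complex) \<Rightarrow> ('x \<Rightarrow> complex)) \<Rightarrow> bool"
  where
  "op_le H A B \<longleftrightarrow> (\<forall>f\<in>funs H. ip H (\<lambda>x. B f x - A f x) f \<in> \<real>\<^sub>\<ge>\<^sub>0)"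

definition mult_op :: "('x \<Rightarrow> complex) \<Rightarrow> ('x \<Rightarrow> complex) \<Rightarrow> ('x \<Rightarrow> complex)" where
  "mult_op b f = (\<lambda>x. b x * f x)"

definition holomorphic_cn_on :: "(complex ^ 'd \<Rightarrow> complex) \<Rightarrow> (complex ^ 'd) set \<Rightarrow> bool" where
  "holomorphic_cn_on f S \<longleftrightarrow>
     (\<forall>z\<in>S. \<exists>D. (f has_derivative D) (at z) \<and> (\<forall>c v. D (c *s v) = c * D v))"

definition herm :: "complex ^ 'd \<Rightarrow> complex ^ 'd \<Rightarrow> complex" where
  "herm z w = (\<Sum>j\<in>UNIV. z $ j * cnj (w $ j))"

text \<open>
  The norm on \<open>complex ^ 'd\<close> is the Euclidean one, so \<open>ball 0 1\<close> is the open unit ball. Holomorphy of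
  the members follows from the kernel; it is stated because it belongs to the definition of the space.
\<close>

definition is_drury_arveson :: "(complex ^ 'd) fspace \<Rightarrow> bool" where
  "is_drury_arveson H \<longleftrightarrow>
     is_rkhs (ball 0 1) (\<lambda>z w. 1 / (1 - herm z w)) H \<and>
     (\<forall>f\<in>funs H. holomorphic_cn_on f (ball 0 1))"

text \<open>
  Here and below, only the values of a multiplier on the ball matter, as members of the space vanish
  elsewhere.
\<close>

definition multiplier :: "(complex ^ 'd) fspace \<Rightarrow> (complex ^ 'd \<Rightarrow> complex) \<Rightarrow> bool" where
  "multiplier H b \<longleftrightarrow>
     holomorphic_cn_on b (ball 0 1) \<and> (\<forall>f\<in>funs H. mult_op b f \<in> funs H)"

definition contractive_multiplier ::
  "(complex ^ 'd) fspace \<Rightarrow> (complex ^ 'd \<Rightarrow> complex) \<Rightarrow> bool" where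
  "contractive_multiplier H b \<longleftrightarrow> multiplier H b \<and> op_norm H (mult_op b) \<le> 1"

definition is_de_branges_rovnyak ::
  "(complex ^ 'd \<Rightarrow> complex) \<Rightarrow> (complex ^ 'd) fspace \<Rightarrow> bool" where
  "is_de_branges_rovnyak b H \<longleftrightarrow>
     is_rkhs (ball 0 1) (\<lambda>z w. (1 - b z * cnj (b w)) / (1 - herm z w)) H"

definition admissible ::
  "(complex ^ 'd) fspace \<Rightarrow> (complex ^ 'd \<Rightarrow> complex) \<Rightarrow> ('d \<Rightarrow> complex ^ 'd \<Rightarrow> complex) \<Rightarrow> bool"
  where
  "admissible Hb b bs \<longleftrightarrow>
     (\<forall>j. bs j \<in> funs Hb) \<and>
     (\<forall>z\<in>ball 0 1. (\<Sum>j\<in>UNIV. z $ j * bs j z) = b z - b 0) \<and>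
     (\<Sum>j\<in>UNIV. (fnorm Hb (bs j))\<^sup>2) \<le> 1 - (norm (b 0))\<^sup>2"

definition quasi_extreme :: "(complex ^ 'd) fspace \<Rightarrow> (complex ^ 'd \<Rightarrow> complex) \<Rightarrow> bool" where
  "quasi_extreme Hb b \<longleftrightarrow>
     (\<forall>bs. admissible Hb b bs \<longrightarrow>
        (\<Sum>j\<in>UNIV. (fnorm Hb (bs j))\<^sup>2) = 1 - (norm (b 0))\<^sup>2)"

end

theory Submission
  imports Defs "HOL-Complex_Analysis.Cauchy_Integral_Formula"
begin

text \<open>
  Both conditions are compared with a third one. Let \<open>Q f = \<parallel>f\<parallel>\<^sup>2 - \<parallel>b f\<parallel>\<^sup>2\<close> on \<open>H\<^sup>2\<^sub>d\<close>; the operator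
  inequality says that \<open>\<parallel>a f\<parallel>\<^sup>2 \<le> Q f\<close> for all \<open>f\<close>. Then \<open>b\<close> fails to be quasi-extreme iff evaluation
  at the origin is \<open>Q\<close>-bounded, \<open>|f 0|\<^sup>2 \<le> C Q f\<close>, iff there is a nonzero \<open>a\<close>.

  The first equivalence: each side says that \<open>b\<close> is a member of \<open>H(b)\<close>. A tuple with strict inequality bounds
  \<open>\<Sum> c\<^sub>w b(w)\<^sup>*\<close> by the norm of \<open>\<Sum> c\<^sub>w k\<^sup>b\<^sub>w\<close>; conversely the tuple is a Riesz representative in \<open>H(b)\<^sup>d\<close>.

  A nonzero \<open>a\<close> makes the evaluation \<open>Q\<close>-bounded because the lowest Taylor coefficient of \<open>a f\<close> on a
  slice is that of \<open>a\<close> times \<open>f 0\<close>.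

  Conversely, replace \<open>b\<close> by \<open>\<surd>\<rho> b\<close> with \<open>\<rho> < 1\<close>, let \<open>u\<close> minimise \<open>Q\<^sub>\<rho>\<close> subject to \<open>u 0 = 1\<close>, with
  minimum \<open>1 / \<kappa>\<close>. If \<open>g 0 = 0\<close> then \<open>Q\<^sub>\<rho> g \<ge> \<Sum>\<^sub>j Q\<^sub>\<rho> (S\<^sub>j\<^sup>* g)\<close>, where \<open>S\<^sub>j\<close> is multiplication by \<open>z\<^sub>j\<close>; applied
  repeatedly to \<open>f - f 0 u\<close>, this expands \<open>f / u\<close> into a series in \<open>H\<^sup>2\<^sub>d\<close> with \<open>\<parallel>f / u\<parallel>\<^sup>2 \<le> \<kappa> Q\<^sub>\<rho> f\<close>.
  So \<open>a\<^sub>\<rho> = 1 / (\<surd>\<kappa> u)\<close> satisfies the inequality for \<open>\<surd>\<rho> b\<close>. As \<open>\<rho>\<close> tends to 1, the \<open>a\<^sub>\<rho>\<close> converge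
  pointwise, and the \<open>Q\<close>-bound keeps the limit from vanishing at the origin.
\<close>

section \<open>Inner product spaces of functions\<close>

locale ip_fspace =
  fixes X :: "'x set" and H :: "'x fspace"
  assumes inner_product_fspace: "inner_product_fspace X H"
begin

lemma mem_outside: "f \<in> funs H \<Longrightarrow> x \<notin> X \<Longrightarrow> f x = 0"
  and mem_zero: "(\<lambda>x. 0) \<in> funs H"
  and mem_lin: "f \<in> funs H \<Longrightarrow> g \<in> funs H \<Longrightarrow> (\<lambda>x. c * f x + g x) \<in> funs H"
  and ip_lin: "f \<in> funs H \<Longrightarrow> g \<in> funs H \<Longrightarrow> h \<in> funs H \<Longrightarrow>
    ip H (\<lambda>x. c * f x + g x) h = c * ip H f h + ip H g h"
  and ip_commute: "f \<in> funs H \<Longrightarrow> g \<in> funs H \<Longrightarrow> ip H g f = cnj (ip H f g)"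
  and ip_self_nonneg: "f \<in> funs H \<Longrightarrow> ip H f f \<in> \<real>\<^sub>\<ge>\<^sub>0"
  and ip_self_eq_0: "f \<in> funs H \<Longrightarrow> ip H f f = 0 \<Longrightarrow> f = (\<lambda>x. 0)"
  using inner_product_fspace unfolding inner_product_fspace_def by blast+

lemma mem_add: "f \<in> funs H \<Longrightarrow> g \<in> funs H \<Longrightarrow> (\<lambda>x. f x + g x) \<in> funs H"
  using mem_lin[of f g 1] by simp

lemma mem_scale: "f \<in> funs H \<Longrightarrow> (\<lambda>x. c * f x) \<in> funs H"
  using mem_lin[of f "\<lambda>x. 0" c] mem_zero by simp

lemma mem_diff: "f \<in> funs H \<Longrightarrow> g \<in> funs H \<Longrightarrow> (\<lambda>x. f x - g x) \<in> funs H"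
  using mem_lin[of g f "-1"] by simp

lemma mem_sum: "(\<And>i. i \<in> I \<Longrightarrow> f i \<in> funs H) \<Longrightarrow> (\<lambda>x. \<Sum>i\<in>I. f i x) \<in> funs H"
  by (induction I rule: infinite_finite_induct) (auto intro: mem_add mem_zero)

lemma ip_add_left:
  "f \<in> funs H \<Longrightarrow> g \<in> funs H \<Longrightarrow> h \<in> funs H \<Longrightarrow> ip H (\<lambda>x. f x + g x) h = ip H f h + ip H g h"
  using ip_lin[of f g h 1] by simp

lemma ip_zero_left: "h \<in> funs H \<Longrightarrow> ip H (\<lambda>x. 0) h = 0"
  using ip_lin[of "\<lambda>x. 0" "\<lambda>x. 0" h 1] mem_zero by simp

lemma ip_scale_left: "f \<in> funs H \<Longrightarrow> h \<in> funs H \<Longrightarrow> ip H (\<lambda>x. c * f x) h = c * ip H f h"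
  using ip_lin[of f "\<lambda>x. 0" h c] mem_zero by (simp add: ip_zero_left)

lemma ip_diff_left:
  "f \<in> funs H \<Longrightarrow> g \<in> funs H \<Longrightarrow> h \<in> funs H \<Longrightarrow> ip H (\<lambda>x. f x - g x) h = ip H f h - ip H g h"
  using ip_lin[of g f h "-1"] by simp

lemma ip_sum_left:
  "(\<And>i. i \<in> I \<Longrightarrow> f i \<in> funs H) \<Longrightarrow> h \<in> funs H \<Longrightarrow>
    ip H (\<lambda>x. \<Sum>i\<in>I. f i x) h = (\<Sum>i\<in>I. ip H (f i) h)"
proof (induction I rule: infinite_finite_induct)
  case (insert i I)
  then show ?case
    using ip_add_left[of "f i" "\<lambda>x. \<Sum>i\<in>I. f i x" h] by (simp add: mem_sum)
qed (auto simp: ip_zero_left)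

lemma ip_add_right:
  "f \<in> funs H \<Longrightarrow> g \<in> funs H \<Longrightarrow> h \<in> funs H \<Longrightarrow> ip H h (\<lambda>x. f x + g x) = ip H h f + ip H h g"
  by (simp add: ip_commute[of _ h] mem_add ip_add_left)

lemma ip_scale_right: "f \<in> funs H \<Longrightarrow> h \<in> funs H \<Longrightarrow> ip H h (\<lambda>x. c * f x) = cnj c * ip H h f"
  by (simp add: ip_commute[of _ h] mem_scale ip_scale_left)

lemma ip_diff_right:
  "f \<in> funs H \<Longrightarrow> g \<in> funs H \<Longrightarrow> h \<in> funs H \<Longrightarrow> ip H h (\<lambda>x. f x - g x) = ip H h f - ip H h g"
  by (simp add: ip_commute[of _ h] mem_diff ip_diff_left)

lemma ip_sum_right:
  assumes "\<And>i. i \<in> I \<Longrightarrow> f i \<in> funs H" "h \<in> funs H"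
  shows "ip H h (\<lambda>x. \<Sum>i\<in>I. f i x) = (\<Sum>i\<in>I. ip H h (f i))"
  using assms by (simp add: ip_commute[of _ h] mem_sum ip_sum_left cnj_sum)

lemma ip_self: "f \<in> funs H \<Longrightarrow> ip H f f = of_real ((fnorm H f)\<^sup>2)"
  using ip_self_nonneg[of f] unfolding fnorm_def complex_nonneg_Reals_iff
  by (simp add: complex_eq_iff)

lemma fnorm_nonneg: "f \<in> funs H \<Longrightarrow> 0 \<le> fnorm H f"
  using ip_self_nonneg[of f] unfolding fnorm_def complex_nonneg_Reals_iff by simp

lemma fnorm_zero: "fnorm H (\<lambda>x. 0) = 0"
  using ip_zero_left[OF mem_zero] by (simp add: fnorm_def)

lemma fnorm_eq_0: "f \<in> funs H \<Longrightarrow> fnorm H f = 0 \<Longrightarrow> f = (\<lambda>x. 0)"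
  using ip_self[of f] ip_self_eq_0[of f] by simp

lemma fnorm_square: "f \<in> funs H \<Longrightarrow> (fnorm H f)\<^sup>2 = Re (ip H f f)"
  using ip_self[of f] by simp

lemma fnorm_square_lin:
  assumes "f \<in> funs H" "g \<in> funs H"
  shows "(fnorm H (\<lambda>x. c * f x + g x))\<^sup>2 =
    (norm c)\<^sup>2 * (fnorm H f)\<^sup>2 + 2 * Re (c * ip H f g) + (fnorm H g)\<^sup>2"
proof -
  have "ip H (\<lambda>x. c * f x + g x) (\<lambda>x. c * f x + g x) =
      c * (cnj c * ip H f f + ip H f g) + (cnj c * ip H g f + ip H g g)"
    using assms by (simp add: ip_lin mem_lin mem_scale ip_add_right ip_scale_right)
  also have "\<dots> = c * cnj c * ip H f f + (c * ip H f g + cnj (c * ip H f g)) + ip H g g"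
    using ip_commute[OF assms] by (simp add: algebra_simps)
  also have "\<dots> = of_real ((norm c)\<^sup>2 * (fnorm H f)\<^sup>2 + 2 * Re (c * ip H f g) + (fnorm H g)\<^sup>2)"
    using assms by (simp only: ip_self complex_norm_square[symmetric] complex_add_cnj)
      (simp only: of_real_add of_real_mult)
  finally show ?thesis
    using assms by (simp only: fnorm_square[OF mem_lin] Re_complex_of_real)
qed

lemma fnorm_scale: "f \<in> funs H \<Longrightarrow> fnorm H (\<lambda>x. c * f x) = norm c * fnorm H f"
  by (rule power2_eq_imp_eq)
    (use fnorm_square_lin[of f "\<lambda>x. 0" c] in
      \<open>simp_all add: mem_zero ip_zero_left ip_commute[of "\<lambda>x. 0" f] fnorm_zero power_mult_distrib
        fnorm_nonneg mem_scale\<close>)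

lemma fnorm_square_diff:
  assumes "f \<in> funs H" "g \<in> funs H"
  shows "(fnorm H (\<lambda>x. f x - g x))\<^sup>2 = (fnorm H f)\<^sup>2 - 2 * Re (ip H f g) + (fnorm H g)\<^sup>2"
  using fnorm_square_lin[OF assms(2,1), of "-1"] ip_commute[OF assms] by simp

lemma fnorm_square_add:
  assumes "f \<in> funs H" "g \<in> funs H"
  shows "(fnorm H (\<lambda>x. f x + g x))\<^sup>2 = (fnorm H f)\<^sup>2 + 2 * Re (ip H f g) + (fnorm H g)\<^sup>2"
  using fnorm_square_lin[OF assms(1,2), of 1] by simp

lemma Cauchy_Schwarz_fspace:
  assumes "f \<in> funs H" "g \<in> funs H"
  shows "norm (ip H f g) \<le> fnorm H f * fnorm H g"
proof (cases "fnorm H f = 0")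
  case True
  then have "f = (\<lambda>x. 0)" using fnorm_eq_0 assms by blast
  then show ?thesis using assms ip_zero_left fnorm_zero by simp
next
  case False
  define p where "p = ip H f g"
  define n where "n = (fnorm H f)\<^sup>2"
  have n: "n > 0" using False by (simp add: n_def)
  \<comment> \<open>The coefficient \<open>- cnj p / n\<close> minimises the norm of
    \<open>c * f + g\<close> over all scalars \<open>c\<close>.\<close>
  have "0 \<le> (norm (- cnj p / of_real n))\<^sup>2 * n + 2 * Re (- cnj p / of_real n * p) + (fnorm H g)\<^sup>2"
    using fnorm_square_lin[OF assms, of "- cnj p / of_real n"] unfolding p_def n_def
    by (metis zero_le_power2)
  moreover have "- cnj p / of_real n * p = of_real (- (norm p)\<^sup>2 / n)"
    using complex_norm_square[of p] by (simp add: mult.commute)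
  ultimately have "0 \<le> (norm p / n)\<^sup>2 * n + 2 * (- (norm p)\<^sup>2 / n) + (fnorm H g)\<^sup>2"
    using n by (simp only: Re_complex_of_real) (simp add: norm_divide)
  also have "\<dots> = (fnorm H g)\<^sup>2 - (norm p)\<^sup>2 / n"
    using n by (simp add: field_simps power2_eq_square)
  finally have "(norm p)\<^sup>2 \<le> (fnorm H f * fnorm H g)\<^sup>2"
    using n by (simp add: n_def power_mult_distrib field_simps)
  then show ?thesis
    using assms fnorm_nonneg p_def by (meson mult_nonneg_nonneg power2_le_imp_le)
qed

lemma fnorm_triangle:
  assumes "f \<in> funs H" "g \<in> funs H"
  shows "fnorm H (\<lambda>x. f x + g x) \<le> fnorm H f + fnorm H g"
proof (rule power2_le_imp_le)
  have "Re (ip H f g) \<le> fnorm H f * fnorm H g"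
    using Cauchy_Schwarz_fspace[OF assms] complex_Re_le_cmod order_trans by blast
  then show "(fnorm H (\<lambda>x. f x + g x))\<^sup>2 \<le> (fnorm H f + fnorm H g)\<^sup>2"
    using fnorm_square_add[OF assms] by (simp add: power2_sum)
qed (use assms fnorm_nonneg in simp)

lemma fnorm_triangle_diff:
  assumes "f \<in> funs H" "g \<in> funs H"
  shows "\<bar>fnorm H f - fnorm H g\<bar> \<le> fnorm H (\<lambda>x. f x - g x)"
proof -
  have "fnorm H f \<le> fnorm H (\<lambda>x. f x - g x) + fnorm H g"
    using fnorm_triangle[OF mem_diff[OF assms] assms(2)] by simp
  moreover have "fnorm H g \<le> fnorm H (\<lambda>x. f x - g x) + fnorm H f"
    using fnorm_triangle[OF mem_diff[OF assms(2,1)] assms(1)] fnorm_scale[OF mem_diff[OF assms], of "-1"]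
    by (simp add: algebra_simps)
  ultimately show ?thesis by linarith
qed

lemma tendsto_ip_left:
  assumes "\<And>n. F n \<in> funs H" "f \<in> funs H" "h \<in> funs H"
    and "(\<lambda>n. fnorm H (\<lambda>x. F n x - f x)) \<longlonglongrightarrow> 0"
  shows "(\<lambda>n. ip H (F n) h) \<longlonglongrightarrow> ip H f h"
proof -
  have "(\<lambda>n. ip H (F n) h - ip H f h) \<longlonglongrightarrow> 0"
  proof (rule Lim_null_comparison)
    show "\<forall>\<^sub>F n in sequentially. norm (ip H (F n) h - ip H f h) \<le> fnorm H (\<lambda>x. F n x - f x) * fnorm H h"
      using Cauchy_Schwarz_fspace[OF mem_diff] assms by (simp add: ip_diff_left[symmetric])
    show "(\<lambda>n. fnorm H (\<lambda>x. F n x - f x) * fnorm H h) \<longlonglongrightarrow> 0"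
      using tendsto_mult[OF assms(4) tendsto_const] by simp
  qed
  then show ?thesis by (simp add: LIM_zero_iff)
qed

lemma tendsto_fnorm:
  assumes "\<And>n. F n \<in> funs H" "f \<in> funs H"
    and "(\<lambda>n. fnorm H (\<lambda>x. F n x - f x)) \<longlonglongrightarrow> 0"
  shows "(\<lambda>n. fnorm H (F n)) \<longlonglongrightarrow> fnorm H f"
proof -
  have "(\<lambda>n. fnorm H (F n) - fnorm H f) \<longlonglongrightarrow> 0"
    by (rule Lim_null_comparison[OF _ assms(3)])
      (use fnorm_triangle_diff assms in \<open>simp add: always_eventually\<close>)
  then show ?thesis by (simp add: LIM_zero_iff)
qed

end

section \<open>Complete spaces: Riesz representation and a uniform boundedness principle\<close>

locale hilbert_fspace = ip_fspace X H for X :: "'x set" and H :: "'x fspace" +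
  assumes complete_fspace: "complete_fspace H"
begin

lemma Cauchy_limit_fspace:
  assumes "\<And>n. F n \<in> funs H"
    and "\<And>e. e > 0 \<Longrightarrow> \<exists>N. \<forall>m\<ge>N. \<forall>n\<ge>N. fnorm H (\<lambda>x. F m x - F n x) < e"
  obtains f where "f \<in> funs H" "(\<lambda>n. fnorm H (\<lambda>x. F n x - f x)) \<longlonglongrightarrow> 0"
  using complete_fspace assms unfolding complete_fspace_def by blast

text \<open>
  The functional is given by its graph \<open>P\<close>, so that it can be prescribed on a spanning family
  without checking beforehand that it is well defined. The representing vector minimises
  \<open>\<parallel>g\<parallel>\<^sup>2 - 2 Re l\<close> over \<open>(g, l) \<in> P\<close>.
\<close>

lemma riesz_graph:
  assumes mem: "\<And>g l. (g, l) \<in> P \<Longrightarrow> g \<in> funs H"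
    and ne: "P \<noteq> {}"
    and lin: "\<And>f s g t c. (f, s) \<in> P \<Longrightarrow> (g, t) \<in> P \<Longrightarrow> ((\<lambda>x. c * f x + g x), c * s + t) \<in> P"
    and bound: "\<And>g l. (g, l) \<in> P \<Longrightarrow> norm l \<le> M * fnorm H g"
    and "0 \<le> M"
  obtains h G where "h \<in> funs H" "\<And>g l. (g, l) \<in> P \<Longrightarrow> ip H g h = l" "fnorm H h \<le> M"
    "\<And>n::nat. G n \<in> fst ` P" "(\<lambda>n. fnorm H (\<lambda>x. G n x - h x)) \<longlonglongrightarrow> 0"
proof -
  define J where "J = (\<lambda>(g, l). (fnorm H g)\<^sup>2 - 2 * Re l)"
  \<comment> \<open>Completing the square: \<open>J\<close> is at least
    \<open>(fnorm H g - M)^2 - M^2\<close>.\<close>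
  have lower: "- M\<^sup>2 \<le> J p" if p: "p \<in> P" for p
  proof -
    obtain g l where gl: "p = (g, l)" by fastforce
    have "Re l \<le> M * fnorm H g"
      using bound[of g l] p gl complex_Re_le_cmod[of l] by simp
    moreover have "0 \<le> (fnorm H g - M)\<^sup>2" by simp
    ultimately show ?thesis by (simp add: J_def gl power2_diff) (simp add: mult.commute)
  qed
  define m where "m = Inf (J ` P)"
  have m_le: "m \<le> J p" if "p \<in> P" for p
    unfolding m_def using that lower by (intro cInf_lower bdd_belowI[of _ "- M\<^sup>2"]) auto
  have "\<exists>p\<in>P. J p < m + 1 / real (Suc n)" for n
    using cInf_lessD[of "J ` P" "m + 1 / real (Suc n)"] ne unfolding m_def by auto
  then obtain p where p: "\<And>n. p n \<in> P" "\<And>n. J (p n) < m + 1 / real (Suc n)" by metis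
  define G where "G n = fst (p n)" for n
  define l where "l n = snd (p n)" for n
  have Gl: "(G n, l n) \<in> P" and JG: "J (G n, l n) < m + 1 / real (Suc n)" for n
    using p by (simp_all add: G_def l_def)
  have GH: "G n \<in> funs H" for n using Gl mem by blast
  have P0: "((\<lambda>x. 0), 0) \<in> P"
    using lin[of "G 0" "l 0" "G 0" "l 0" "-1"] Gl by simp
  \<comment> \<open>Parallelogram law: the midpoint of two pairs lies in \<open>P\<close>, so
    \<open>J\<close> there is at least \<open>m\<close>. Two near-minimisers are therefore close,
    which makes a minimising sequence Cauchy.\<close>
  have par: "(fnorm H (\<lambda>x. f x - g x))\<^sup>2 \<le> 2 * (J (f, s) + J (g, t) - 2 * m)"
    if fs: "(f, s) \<in> P" and gt: "(g, t) \<in> P" for f s g t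
  proof -
    have sum: "((\<lambda>x. f x + g x), s + t) \<in> P" using lin[OF fs gt, of 1] by simp
    have "((\<lambda>x. (1/2) * (f x + g x)), (1/2) * (s + t)) \<in> P"
      using lin[OF sum P0, of "1/2"] by simp
    from m_le[OF this] have "m \<le> (fnorm H (\<lambda>x. f x + g x))\<^sup>2 / 4 - (Re s + Re t)"
      unfolding J_def prod.case fnorm_scale[OF mem[OF sum]] by (simp add: power_divide add_divide_distrib)
    then show ?thesis
      using fnorm_square_add[OF mem[OF fs] mem[OF gt]] fnorm_square_diff[OF mem[OF fs] mem[OF gt]]
      unfolding J_def prod.case by argo
  qed
  have "\<exists>N. \<forall>m\<ge>N. \<forall>n\<ge>N. fnorm H (\<lambda>x. G m x - G n x) < e" if e: "e > 0" for e
  proof -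
    obtain N where N: "4 / e\<^sup>2 < real N" using reals_Archimedean2 by blast
    have "fnorm H (\<lambda>x. G i x - G j x) < e" if "i \<ge> N" "j \<ge> N" for i j
    proof -
      have *: "1 / real (Suc k) < e\<^sup>2 / 4" if "k \<ge> N" for k
      proof -
        have "4 / e\<^sup>2 < real (Suc k)" using N that by linarith
        then show ?thesis using e by (simp add: field_simps)
      qed
      have "(fnorm H (\<lambda>x. G i x - G j x))\<^sup>2 < e\<^sup>2"
        using par[OF Gl Gl, of i j] JG[of i] JG[of j] *[OF that(1)] *[OF that(2)] by argo
      then show ?thesis using e power2_less_imp_less by fastforce
    qed
    then show ?thesis by blast
  qed
  from Cauchy_limit_fspace[OF GH this] obtain h
    where h: "h \<in> funs H" "(\<lambda>n. fnorm H (\<lambda>x. G n x - h x)) \<longlonglongrightarrow> 0" by metis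
  have rep: "ip H g h = t" if gt: "(g, t) \<in> P" for g t
  proof -
    have g: "g \<in> funs H" using gt mem by blast
    define \<delta> where "\<delta> = ip H g h - t"
    have lim: "(\<lambda>n. ip H g (G n)) \<longlonglongrightarrow> ip H g h"
      using tendsto_cnj[OF tendsto_ip_left[OF GH h(1) g h(2)]]
      by (simp add: ip_commute[of _ g] GH h g)
    \<comment> \<open>First variation: moving the near-minimiser \<open>G n\<close> by
      \<open>c * g\<close> can lower \<open>J\<close> by less than \<open>1 / (n + 1)\<close>, and
      the limit leaves no loss.\<close>
    have var: "0 \<le> 2 * Re (c * \<delta>) + (norm c)\<^sup>2 * (fnorm H g)\<^sup>2" for c
    proof (rule LIMSEQ_le)
      show "(\<lambda>n. - (1 / real (Suc n))) \<longlonglongrightarrow> 0"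
        using tendsto_minus[OF LIMSEQ_inverse_real_of_nat] by (simp add: divide_inverse)
      show "(\<lambda>n. 2 * Re (c * (ip H g (G n) - t)) + (norm c)\<^sup>2 * (fnorm H g)\<^sup>2)
          \<longlonglongrightarrow> 2 * Re (c * \<delta>) + (norm c)\<^sup>2 * (fnorm H g)\<^sup>2"
        unfolding \<delta>_def by (intro tendsto_intros lim)
      have "- (1 / real (Suc n)) \<le> 2 * Re (c * (ip H g (G n) - t)) + (norm c)\<^sup>2 * (fnorm H g)\<^sup>2" for n
        using m_le[OF lin[OF gt Gl[of n], of c]] JG[of n] fnorm_square_lin[OF g GH[of n], of c]
        by (simp add: J_def algebra_simps)
      then show "\<exists>N. \<forall>n\<ge>N. - (1 / real (Suc n)) \<le>
          2 * Re (c * (ip H g (G n) - t)) + (norm c)\<^sup>2 * (fnorm H g)\<^sup>2" by blast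
    qed
    define a where "a = (fnorm H g)\<^sup>2"
    have a: "a \<ge> 0" by (simp add: a_def)
    \<comment> \<open>The direction \<open>c = - s * cnj \<delta>\<close> turns the variation into
      \<open>- s * |\<delta>|^2 * (2 - s * a)\<close>. With this \<open>s\<close> the product
      \<open>s * a\<close> stays below 1, also when \<open>a = 0\<close>, so the sign forces
      \<open>\<delta> = 0\<close>.\<close>
    define s where "s = 1 / (a + 1)"
    have "0 \<le> 2 * Re (of_real (- s) * cnj \<delta> * \<delta>) + (norm (of_real (- s) * cnj \<delta>))\<^sup>2 * a"
      using var[of "of_real (- s) * cnj \<delta>"] unfolding a_def .
    moreover have "of_real (- s) * cnj \<delta> * \<delta> = of_real (- s * (norm \<delta>)\<^sup>2)"
      using complex_norm_square[of \<delta>] by (simp add: mult.commute)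
    ultimately have "0 \<le> 2 * (- s * (norm \<delta>)\<^sup>2) + s\<^sup>2 * (norm \<delta>)\<^sup>2 * a"
      by (simp only: Re_complex_of_real norm_mult complex_mod_cnj) (simp add: power_mult_distrib)
    also have "\<dots> = - (s * (norm \<delta>)\<^sup>2 * (2 - s * a))" by (simp add: power2_eq_square algebra_simps)
    finally have "s * (norm \<delta>)\<^sup>2 * (2 - s * a) \<le> 0" by simp
    moreover have "s > 0" "2 - s * a > 0" using a by (simp_all add: s_def field_simps)
    ultimately have "(norm \<delta>)\<^sup>2 \<le> 0"
      by (metis mult_le_0_iff not_le zero_le_power2 mult_pos_pos)
    then show ?thesis by (simp add: \<delta>_def)
  qed
  have "(fnorm H h)\<^sup>2 \<le> M * fnorm H h"
  proof (rule LIMSEQ_le)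
    show "(\<lambda>n. Re (ip H (G n) h)) \<longlonglongrightarrow> (fnorm H h)\<^sup>2"
      using tendsto_Re[OF tendsto_ip_left[OF GH h(1) h(1) h(2)]] by (simp add: fnorm_square h)
    show "(\<lambda>n. M * fnorm H (G n)) \<longlonglongrightarrow> M * fnorm H h"
      by (intro tendsto_intros tendsto_fnorm GH h)
    have "Re (ip H (G n) h) \<le> M * fnorm H (G n)" for n
      using bound[OF Gl[of n]] complex_Re_le_cmod[of "l n"] rep[OF Gl] by simp
    then show "\<exists>N. \<forall>n\<ge>N. Re (ip H (G n) h) \<le> M * fnorm H (G n)" by blast
  qed
  then have "fnorm H h \<le> M"
    using \<open>0 \<le> M\<close> fnorm_nonneg[OF h(1)] by (cases "fnorm H h = 0") (auto simp: power2_eq_square)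
  moreover have "G n \<in> fst ` P" for n using Gl by force
  ultimately show ?thesis using that h rep by blast
qed

text \<open>The pairs of finite combinations of \<open>v i\<close> and \<open>l i\<close> form a
  graph for \<open>riesz_graph\<close>, and the bound takes care of well-definedness. The
  approximating combinations are kept because they later give density of the kernel
  functions.\<close>

lemma riesz_family:
  assumes v: "\<And>i. i \<in> I \<Longrightarrow> v i \<in> funs H"
    and bound: "\<And>W c. finite W \<Longrightarrow> W \<subseteq> I \<Longrightarrow>
      norm (\<Sum>i\<in>W. c i * l i) \<le> M * fnorm H (\<lambda>x. \<Sum>i\<in>W. c i * v i x)"
    and "0 \<le> M"
  obtains h W c where "h \<in> funs H" "\<And>i. i \<in> I \<Longrightarrow> ip H (v i) h = l i" "fnorm H h \<le> M"
    "\<And>n::nat. finite (W n) \<and> W n \<subseteq> I"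
    "(\<lambda>n. fnorm H (\<lambda>x. (\<Sum>i\<in>W n. c n i * v i x) - h x)) \<longlonglongrightarrow> 0"
proof -
  define P where "P = {((\<lambda>x. \<Sum>i\<in>W. c i * v i x), \<Sum>i\<in>W. c i * l i) |W c. finite W \<and> W \<subseteq> I}"
  have PI: "((\<lambda>x. \<Sum>i\<in>W. c i * v i x), \<Sum>i\<in>W. c i * l i) \<in> P" if "finite W" "W \<subseteq> I" for W c
    unfolding P_def using that by blast
  have lin: "((\<lambda>x. c * f x + g x), c * s + t) \<in> P" if fs: "(f, s) \<in> P" and gt: "(g, t) \<in> P" for f s g t c
  proof -
    obtain W1 c1 where 1: "f = (\<lambda>x. \<Sum>i\<in>W1. c1 i * v i x)" "s = (\<Sum>i\<in>W1. c1 i * l i)"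
      "finite W1" "W1 \<subseteq> I" using fs unfolding P_def by blast
    obtain W2 c2 where 2: "g = (\<lambda>x. \<Sum>i\<in>W2. c2 i * v i x)" "t = (\<Sum>i\<in>W2. c2 i * l i)"
      "finite W2" "W2 \<subseteq> I" using gt unfolding P_def by blast
    \<comment> \<open>Both coefficient families are extended by 0 to the union of their index
      sets.\<close>
    define e where "e i = c * (if i \<in> W1 then c1 i else 0) + (if i \<in> W2 then c2 i else 0)" for i
    have "(\<Sum>i\<in>W1 \<union> W2. e i * y i) = c * (\<Sum>i\<in>W1. c1 i * y i) + (\<Sum>i\<in>W2. c2 i * y i)" for y
    proof -
      have "(\<Sum>i\<in>W1. c1 i * y i) = (\<Sum>i\<in>W1 \<union> W2. (if i \<in> W1 then c1 i else 0) * y i)"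
        using 1 2 by (intro sum.mono_neutral_cong_left) auto
      moreover have "(\<Sum>i\<in>W2. c2 i * y i) = (\<Sum>i\<in>W1 \<union> W2. (if i \<in> W2 then c2 i else 0) * y i)"
        using 1 2 by (intro sum.mono_neutral_cong_left) auto
      ultimately show ?thesis
        by (simp only: e_def distrib_right sum.distrib sum_distrib_left mult.assoc)
    qed
    then show ?thesis using PI[of "W1 \<union> W2" e] 1 2 by simp
  qed
  have ne: "P \<noteq> {}" using PI[of "{}"] by blast
  have mem: "g \<in> funs H" if "(g, t) \<in> P" for g t
    using that unfolding P_def by (auto intro!: mem_sum mem_scale v)
  have bnd: "norm t \<le> M * fnorm H g" if "(g, t) \<in> P" for g t
    using that bound unfolding P_def by auto
  obtain h G where h: "h \<in> funs H" "\<And>g t. (g, t) \<in> P \<Longrightarrow> ip H g h = t"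
    "fnorm H h \<le> M" and G: "\<And>n::nat. G n \<in> fst ` P" "(\<lambda>n. fnorm H (\<lambda>x. G n x - h x)) \<longlonglongrightarrow> 0"
    by (rule riesz_graph[of P M])
      (erule mem, rule ne, erule (1) lin, erule bnd, rule \<open>0 \<le> M\<close>, blast)
  have "ip H (v i) h = l i" if "i \<in> I" for i
    using h(2)[OF PI[of "{i}" "\<lambda>_. 1"]] that by simp
  moreover have "\<exists>W c. G n = (\<lambda>x. \<Sum>i\<in>W. c i * v i x) \<and> finite W \<and> W \<subseteq> I" for n
    using G(1)[of n] unfolding P_def by force
  then obtain W c where "\<And>n. G n = (\<lambda>x. \<Sum>i\<in>W n. c n i * v i x) \<and> finite (W n) \<and> W n \<subseteq> I" by metis
  ultimately show ?thesis using that[of h W c] h G by simp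
qed

text \<open>Sokal's argument: at the \<open>n\<close>-th step move by \<open>3\<^sup>-\<^sup>n\<close> along \<open>\<plusminus>g\<^sub>n\<close>, with the sign that does not
  decrease the modulus of the \<open>n\<close>-th functional.\<close>

lemma weakly_bounded_not_exponential:
  assumes g: "\<And>n. g n \<in> funs H" and large: "\<And>n::nat. 4 ^ n \<le> fnorm H (g n)"
    and weak: "\<And>f. f \<in> funs H \<Longrightarrow> \<exists>C. \<forall>n. norm (ip H f (g n)) \<le> C"
  shows False
proof -
  have gpos: "fnorm H (g n) > 0" for n
    using large[of n] zero_less_power[of "4::real" n] by linarith
  define e where "e n = (\<lambda>x. of_real ((1/3) ^ n / fnorm H (g n)) * g n x)" for n
  have e: "e n \<in> funs H" for n unfolding e_def using g mem_scale by blast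
  have en: "fnorm H (e n) = (1/3) ^ n" for n
    using gpos[of n] unfolding e_def fnorm_scale[OF g] by (simp add: norm_divide norm_power)
  have eg: "ip H (e n) (g n) = of_real ((1/3) ^ n * fnorm H (g n))" for n
    using gpos[of n] unfolding e_def ip_scale_left[OF g g]
    by (simp add: g ip_self power2_eq_square)
  define step where "step n x =
    (if norm (ip H x (g n)) \<le> norm (ip H x (g n) + ip H (e n) (g n)) \<and>
        (1/3) ^ n * fnorm H (g n) \<le> norm (ip H x (g n) + ip H (e n) (g n))
     then (\<lambda>y. x y + e n y) else (\<lambda>y. x y - e n y))" for n x
  define x where "x = rec_nat (\<lambda>y. 0) step"
  have x0: "x 0 = (\<lambda>y. 0)" and xS: "x (Suc n) = step n (x n)" for n by (simp_all add: x_def)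
  have xH: "x n \<in> funs H" for n
    by (induction n) (auto simp: x0 xS step_def intro: mem_zero mem_add mem_diff e)
  \<comment> \<open>Parallelogram law: when the plus sign is rejected, the square of
    \<open>norm (p + q)\<close> is at most the sum of the squares of \<open>norm p\<close> and
    \<open>norm q\<close>, so that of \<open>norm (p - q)\<close> is at least this sum.\<close>
  have two: "norm q \<le> norm (p - q)" if "\<not> (norm p \<le> norm (p + q) \<and> norm q \<le> norm (p + q))" for p q :: complex
  proof -
    have "(norm (p + q))\<^sup>2 + (norm (p - q))\<^sup>2 = 2 * (norm p)\<^sup>2 + 2 * (norm q)\<^sup>2"
      unfolding cmod_power2 by (simp add: power2_eq_square algebra_simps)
    moreover have "(norm (p + q))\<^sup>2 \<le> (norm p)\<^sup>2 + (norm q)\<^sup>2"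
    proof (cases "norm p \<le> norm (p + q)")
      case True
      then have "(norm (p + q))\<^sup>2 \<le> (norm q)\<^sup>2" using that by (intro power_mono) auto
      then show ?thesis by (smt (verit) zero_le_power2)
    next
      case False
      then have "(norm (p + q))\<^sup>2 \<le> (norm p)\<^sup>2" by (intro power_mono) auto
      then show ?thesis by (smt (verit) zero_le_power2)
    qed
    ultimately have "(norm q)\<^sup>2 \<le> (norm (p - q))\<^sup>2" by (smt (verit) zero_le_power2)
    then show ?thesis by (simp add: power2_le_iff_abs_le)
  qed
  have big: "(1/3) ^ n * fnorm H (g n) \<le> norm (ip H (x (Suc n)) (g n))" for n
    using two[of "ip H (x n) (g n)" "ip H (e n) (g n)"] gpos[of n]
    by (auto simp: xS step_def ip_add_left ip_diff_left xH e g eg norm_mult norm_power)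
  have inc: "fnorm H (\<lambda>y. x (Suc n) y - x n y) = (1/3) ^ n" for n
    using fnorm_scale[OF e[of n], of "-1"] by (auto simp: xS step_def en)
  \<comment> \<open>Geometric increments of ratio 1/3; the factor 3/2 is
    \<open>1 / (1 - 1/3)\<close>.\<close>
  have tail: "fnorm H (\<lambda>y. x (n + k) y - x n y) \<le> (3/2) * ((1/3) ^ n - (1/3) ^ (n + k))" for n k
  proof (induction k)
    case (Suc k)
    have "(\<lambda>y. x (n + Suc k) y - x n y) =
        (\<lambda>y. (x (Suc (n + k)) y - x (n + k) y) + (x (n + k) y - x n y))" by auto
    then have "fnorm H (\<lambda>y. x (n + Suc k) y - x n y) \<le>
        (1/3) ^ (n + k) + fnorm H (\<lambda>y. x (n + k) y - x n y)"
      using fnorm_triangle[OF mem_diff[OF xH xH] mem_diff[OF xH xH], of "Suc (n + k)" "n + k" "n + k" n]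
        inc[of "n + k"] by simp
    moreover have eq: "(1/3 :: real) ^ (n + Suc k) = (1/3) ^ (n + k) / 3" by simp
    ultimately show ?case using Suc unfolding eq by argo
  qed (simp add: fnorm_zero)
  have tail': "fnorm H (\<lambda>y. x m y - x n y) \<le> (3/2) * (1/3) ^ n" if "n \<le> m" for m n
  proof -
    have "fnorm H (\<lambda>y. x m y - x n y) \<le> (3/2) * ((1/3) ^ n - (1/3) ^ m)"
      using tail[of n "m - n"] that by simp
    moreover have "0 \<le> (1/3 :: real) ^ m" by simp
    ultimately show ?thesis by argo
  qed
  have "\<exists>N. \<forall>m\<ge>N. \<forall>n\<ge>N. fnorm H (\<lambda>y. x m y - x n y) < r" if r: "r > 0" for r
  proof -
    obtain N where N: "(1/3::real) ^ N < r / 3"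
      using real_arch_pow_inv[of "r / 3" "1/3"] r by auto
    have "fnorm H (\<lambda>y. x m y - x n y) < r" if "m \<ge> N" "n \<ge> N" for m n
    proof -
      have "fnorm H (\<lambda>y. x m y - x n y) \<le> fnorm H (\<lambda>y. x m y - x N y) + fnorm H (\<lambda>y. x N y - x n y)"
        using fnorm_triangle[OF mem_diff[OF xH xH] mem_diff[OF xH xH], of m N N n] by simp
      moreover have "fnorm H (\<lambda>y. x N y - x n y) = fnorm H (\<lambda>y. x n y - x N y)"
        using fnorm_scale[OF mem_diff[OF xH xH], of "-1" n N] by simp
      ultimately show ?thesis using tail'[OF that(1)] tail'[OF that(2)] N by linarith
    qed
    then show ?thesis by blast
  qed
  from Cauchy_limit_fspace[OF xH this] obtain f
    where f: "f \<in> funs H" "(\<lambda>n. fnorm H (\<lambda>y. x n y - f y)) \<longlonglongrightarrow> 0" by metis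
  have dist: "fnorm H (\<lambda>y. f y - x n y) \<le> (3/2) * (1/3) ^ n" for n
  proof (rule LIMSEQ_le_const2)
    show "(\<lambda>m. fnorm H (\<lambda>y. x m y - x n y)) \<longlonglongrightarrow> fnorm H (\<lambda>y. f y - x n y)"
      by (rule tendsto_fnorm) (use f xH mem_diff in auto)
    show "\<exists>N. \<forall>m\<ge>N. fnorm H (\<lambda>y. x m y - x n y) \<le> (3/2) * (1/3) ^ n" using tail' by blast
  qed
  obtain C where C: "\<And>n. norm (ip H f (g n)) \<le> C" using weak[OF f(1)] by blast
  \<comment> \<open>All moves after the \<open>n\<close>-th add up to at most
    \<open>(3/2) * (1/3) ^ Suc n\<close>, half of the \<open>n\<close>-th one. So half of the gain
    in \<open>big\<close> survives in the limit \<open>f\<close>.\<close>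
  have growth: "(1/2) * (4/3) ^ n \<le> C" for n
  proof -
    have "norm (ip H (\<lambda>y. f y - x (Suc n) y) (g n)) \<le> (3/2) * (1/3) ^ Suc n * fnorm H (g n)"
      using Cauchy_Schwarz_fspace[OF mem_diff[OF f(1) xH[of "Suc n"]] g[of n]]
        mult_right_mono[OF dist[of "Suc n"] fnorm_nonneg[OF g[of n]]] by linarith
    moreover have "norm (ip H (x (Suc n)) (g n)) \<le>
        norm (ip H f (g n)) + norm (ip H (\<lambda>y. f y - x (Suc n) y) (g n))"
      using norm_triangle_ineq4[of "ip H f (g n)" "ip H (\<lambda>y. f y - x (Suc n) y) (g n)"]
      by (simp add: ip_diff_left f xH g)
    ultimately have "(1/2) * ((1/3) ^ n * fnorm H (g n)) \<le> C"
      using big[of n] C[of n] by simp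
    moreover have "(1/3) ^ n * 4 ^ n \<le> (1/3) ^ n * fnorm H (g n)"
      using large[of n] by (intro mult_left_mono) auto
    moreover have "(4/3 :: real) ^ n = (1/3) ^ n * 4 ^ n" by (simp add: power_mult_distrib[symmetric])
    ultimately show ?thesis by linarith
  qed
  obtain n where "2 * C < (4/3 :: real) ^ n" using real_arch_pow[of "4/3" "2 * C"] by auto
  then show False using growth[of n] by linarith
qed

end

section \<open>Adjoints of bounded operators\<close>

context hilbert_fspace
begin

text \<open>The description in \<open>adj\<close> is proper because the functional
  \<open>f \<mapsto> ip H (T f) g\<close> is bounded: Riesz representation gives a representing
  vector, and two such vectors differ by one orthogonal to itself.\<close>

lemma
  assumes T: "\<And>f. f \<in> funs H \<Longrightarrow> T f \<in> funs H"
    and lin: "\<And>f g c. f \<in> funs H \<Longrightarrow> g \<in> funs H \<Longrightarrow> T (\<lambda>x. c * f x + g x) = (\<lambda>x. c * T f x + T g x)"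
    and bound: "\<And>f. f \<in> funs H \<Longrightarrow> fnorm H (T f) \<le> C * fnorm H f"
    and g: "g \<in> funs H"
  shows adj_mem: "adj H T g \<in> funs H"
    and ip_adj: "f \<in> funs H \<Longrightarrow> ip H f (adj H T g) = ip H (T f) g"
proof -
  define M where "M = \<bar>C\<bar> * fnorm H g"
  define P where "P = {(f, ip H (T f) g) |f. f \<in> funs H}"
  have "0 \<le> M" using fnorm_nonneg[OF g] by (simp add: M_def)
  moreover have "norm (ip H (T f) g) \<le> M * fnorm H f" if f: "f \<in> funs H" for f
  proof -
    have "norm (ip H (T f) g) \<le> fnorm H (T f) * fnorm H g"
      using Cauchy_Schwarz_fspace T f g by blast
    also have "\<dots> \<le> (\<bar>C\<bar> * fnorm H f) * fnorm H g"
      using bound[OF f] fnorm_nonneg[OF f] fnorm_nonneg[OF g] mult_right_mono[OF abs_ge_self, of "fnorm H f" C]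
      by (intro mult_right_mono) linarith+
    finally show ?thesis by (simp add: M_def mult_ac)
  qed
  moreover have "((\<lambda>x. c * f x + f' x), c * s + t) \<in> P" if "(f, s) \<in> P" "(f', t) \<in> P" for f s f' t c
    using that lin T g by (auto simp: P_def intro!: exI[of _ "\<lambda>x. c * f x + f' x"] mem_lin ip_lin[symmetric])
  ultimately obtain h where h: "h \<in> funs H" "\<And>f t. (f, t) \<in> P \<Longrightarrow> ip H f h = t"
    using riesz_graph[of P M] mem_zero unfolding P_def by (smt (verit) Pair_inject empty_iff mem_Collect_eq)
  have ex: "h \<in> funs H \<and> (\<forall>f\<in>funs H. ip H (T f) g = ip H f h)"
    using h unfolding P_def by force
  have "h' = h" if h': "h' \<in> funs H \<and> (\<forall>f\<in>funs H. ip H (T f) g = ip H f h')" for h'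
  proof -
    have "ip H (\<lambda>x. h' x - h x) (\<lambda>x. h' x - h x) = 0"
      using ex h' mem_diff[of h' h] by (simp add: ip_diff_right)
    then have "(\<lambda>x. h' x - h x) = (\<lambda>x. 0)" using ip_self_eq_0 mem_diff ex h' by blast
    then show ?thesis by (metis eq_iff_diff_eq_0 ext)
  qed
  then have "adj H T g = h" unfolding adj_def using ex by (intro the_equality) auto
  then show "adj H T g \<in> funs H" "f \<in> funs H \<Longrightarrow> ip H f (adj H T g) = ip H (T f) g"
    using ex by auto
qed

end

section \<open>Reproducing kernel Hilbert spaces\<close>

locale rkhs =
  fixes X :: "'x set" and k :: "'x \<Rightarrow> 'x \<Rightarrow> complex" and H :: "'x fspace"
  assumes is_rkhs: "is_rkhs X k H"
begin

sublocale hilbert_fspace X H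
  using is_rkhs by unfold_locales (auto simp: is_rkhs_def)

abbreviation K :: "'x \<Rightarrow> 'x \<Rightarrow> complex" where "K \<equiv> kernel_at X k"

definition kernel_comb :: "'x set \<Rightarrow> ('x \<Rightarrow> complex) \<Rightarrow> 'x \<Rightarrow> complex" where
  "kernel_comb W c = (\<lambda>z. \<Sum>w\<in>W. c w * K w z)"

lemma K_mem: "w \<in> X \<Longrightarrow> K w \<in> funs H"
  and ip_K: "w \<in> X \<Longrightarrow> f \<in> funs H \<Longrightarrow> ip H f (K w) = f w"
  using is_rkhs unfolding is_rkhs_def by auto

lemma ip_K_left: "w \<in> X \<Longrightarrow> f \<in> funs H \<Longrightarrow> ip H (K w) f = cnj (f w)"
  using ip_commute[of f "K w"] ip_K K_mem by metis

lemma kernel_comb_mem: "W \<subseteq> X \<Longrightarrow> kernel_comb W c \<in> funs H"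
  unfolding kernel_comb_def by (intro mem_sum mem_scale K_mem) auto

lemma ip_kernel_comb:
  assumes "W \<subseteq> X" "f \<in> funs H"
  shows "ip H (kernel_comb W c) f = (\<Sum>w\<in>W. c w * cnj (f w))"
proof -
  have "ip H (kernel_comb W c) f = (\<Sum>w\<in>W. ip H (\<lambda>z. c w * K w z) f)"
    unfolding kernel_comb_def using assms by (intro ip_sum_left mem_scale K_mem) auto
  also have "\<dots> = (\<Sum>w\<in>W. c w * cnj (f w))"
    using assms by (intro sum.cong) (auto simp: ip_scale_left K_mem ip_K_left)
  finally show ?thesis .
qed

lemma fnorm_square_kernel_comb:
  assumes "W \<subseteq> X"
  shows "of_real ((fnorm H (kernel_comb W c))\<^sup>2) = (\<Sum>w\<in>W. \<Sum>v\<in>W. c w * cnj (c v) * cnj (k w v))"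
proof -
  have "of_real ((fnorm H (kernel_comb W c))\<^sup>2) = (\<Sum>w\<in>W. c w * cnj (kernel_comb W c w))"
    using ip_self ip_kernel_comb assms kernel_comb_mem by metis
  also have "\<dots> = (\<Sum>w\<in>W. c w * (\<Sum>v\<in>W. cnj (c v) * cnj (k w v)))"
    using assms by (intro sum.cong refl arg_cong2[where f = "(*)"])
      (auto simp: kernel_comb_def kernel_at_def)
  finally show ?thesis by (simp add: sum_distrib_left mult.assoc)
qed

lemma kernel_hermitian: "v \<in> X \<Longrightarrow> w \<in> X \<Longrightarrow> cnj (k w v) = k v w"
  using ip_K[of v "K w"] ip_K_left[of w "K v"] K_mem by (simp add: kernel_at_def)

lemma rkhs_ext: "f \<in> funs H \<Longrightarrow> \<phi> \<in> funs H \<Longrightarrow> (\<And>x. x \<in> X \<Longrightarrow> f x = \<phi> x) \<Longrightarrow> f = \<phi>"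
  using mem_outside by (metis ext)

text \<open>The functional sending \<open>K w\<close> to \<open>cnj (\<phi> w)\<close> has a Riesz
  vector, and by the reproducing property this vector takes the values of \<open>\<phi>\<close>.
  Membership and norm bounds are obtained through this criterion below.\<close>

lemma
  assumes zero: "\<And>x. x \<notin> X \<Longrightarrow> \<phi> x = 0" and M: "0 \<le> M"
    and bound: "\<And>W c. finite W \<Longrightarrow> W \<subseteq> X \<Longrightarrow>
      norm (\<Sum>w\<in>W. c w * cnj (\<phi> w)) \<le> M * fnorm H (kernel_comb W c)"
  shows mem_rkhsI: "\<phi> \<in> funs H"
    and fnorm_rkhs_le: "fnorm H \<phi> \<le> M"
    and kernel_comb_dense: "\<exists>W c. (\<forall>n::nat. finite (W n) \<and> W n \<subseteq> X) \<and>
      (\<lambda>n. fnorm H (\<lambda>x. kernel_comb (W n) (c n) x - \<phi> x)) \<longlonglongrightarrow> 0"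
proof -
  obtain h W c where h: "h \<in> funs H" "\<And>w. w \<in> X \<Longrightarrow> ip H (K w) h = cnj (\<phi> w)" "fnorm H h \<le> M"
    and W: "\<And>n::nat. finite (W n) \<and> W n \<subseteq> X"
      "(\<lambda>n. fnorm H (\<lambda>x. (\<Sum>w\<in>W n. c n w * K w x) - h x)) \<longlonglongrightarrow> 0"
    by (rule riesz_family[of X K "\<lambda>w. cnj (\<phi> w)" M])
      (erule K_mem, erule (1) bound[unfolded kernel_comb_def], rule M, blast)
  have "h = \<phi>"
  proof
    fix x show "h x = \<phi> x"
      using h(1,2) zero mem_outside ip_K_left by (cases "x \<in> X") (metis complex_cnj_cnj, metis)
  qed
  then show "\<phi> \<in> funs H" "fnorm H \<phi> \<le> M"
    "\<exists>W c. (\<forall>n::nat. finite (W n) \<and> W n \<subseteq> X) \<and>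
      (\<lambda>n. fnorm H (\<lambda>x. kernel_comb (W n) (c n) x - \<phi> x)) \<longlonglongrightarrow> 0"
    using h W unfolding kernel_comb_def by blast+
qed

lemma ip_kernel_comb_bound:
  assumes "W \<subseteq> X" "f \<in> funs H"
  shows "norm (\<Sum>w\<in>W. c w * cnj (f w)) \<le> fnorm H f * fnorm H (kernel_comb W c)"
  using Cauchy_Schwarz_fspace[OF kernel_comb_mem[OF assms(1)] assms(2)] ip_kernel_comb[OF assms]
  by (simp add: mult.commute)

text \<open>By Cauchy-Schwarz every member meets the criterion with its own norm as bound, so
  density comes with the Riesz vector.\<close>

lemma kernel_comb_approx:
  assumes "f \<in> funs H"
  obtains W c where "\<And>n::nat. finite (W n)" "\<And>n. W n \<subseteq> X"
    "(\<lambda>n. fnorm H (\<lambda>x. kernel_comb (W n) (c n) x - f x)) \<longlonglongrightarrow> 0"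
proof -
  have "\<exists>W c. (\<forall>n::nat. finite (W n) \<and> W n \<subseteq> X) \<and>
      (\<lambda>n. fnorm H (\<lambda>x. kernel_comb (W n) (c n) x - f x)) \<longlonglongrightarrow> 0"
    by (rule kernel_comb_dense[of f "fnorm H f"])
      (erule mem_outside[OF assms], rule fnorm_nonneg[OF assms], erule ip_kernel_comb_bound[OF _ assms])
  then show ?thesis using that by blast
qed

text \<open>The membership criterion looks at finitely many values at a time and so survives
  pointwise limits. This takes the place of weak compactness.\<close>

lemma
  assumes F: "\<And>n::nat. F n \<in> funs H" and bound: "\<And>n. fnorm H (F n) \<le> M n" and M: "M \<longlonglongrightarrow> B"
    and lim: "\<And>x. x \<in> X \<Longrightarrow> (\<lambda>n. F n x) \<longlonglongrightarrow> \<phi> x" and zero: "\<And>x. x \<notin> X \<Longrightarrow> \<phi> x = 0"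
  shows pointwise_limit_mem: "\<phi> \<in> funs H" and pointwise_limit_fnorm: "fnorm H \<phi> \<le> B"
proof -
  have "0 \<le> M n" for n using bound[of n] fnorm_nonneg[OF F[of n]] by linarith
  then have B: "0 \<le> B" using M LIMSEQ_le_const by blast
  have *: "norm (\<Sum>w\<in>W. c w * cnj (\<phi> w)) \<le> B * fnorm H (kernel_comb W c)" if "finite W" "W \<subseteq> X" for W c
  proof (rule LIMSEQ_le)
    show "(\<lambda>n. norm (\<Sum>w\<in>W. c w * cnj (F n w))) \<longlonglongrightarrow> norm (\<Sum>w\<in>W. c w * cnj (\<phi> w))"
      using that by (intro tendsto_intros lim) auto
    show "(\<lambda>n. M n * fnorm H (kernel_comb W c)) \<longlonglongrightarrow> B * fnorm H (kernel_comb W c)"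
      by (intro tendsto_intros M)
    have "norm (\<Sum>w\<in>W. c w * cnj (F n w)) \<le> M n * fnorm H (kernel_comb W c)" for n
      using ip_kernel_comb_bound[OF that(2) F[of n]] that
        mult_right_mono[OF bound[of n] fnorm_nonneg[OF kernel_comb_mem[OF that(2)]]]
      by (meson order_trans)
    then show "\<exists>N. \<forall>n\<ge>N. norm (\<Sum>w\<in>W. c w * cnj (F n w)) \<le> M n * fnorm H (kernel_comb W c)"
      by blast
  qed
  show "\<phi> \<in> funs H" by (rule mem_rkhsI[of \<phi> B]) (erule zero, rule B, erule (1) *)
  show "fnorm H \<phi> \<le> B" by (rule fnorm_rkhs_le[of \<phi> B]) (erule zero, rule B, erule (1) *)
qed

lemma norm_eval_le:
  assumes "w \<in> X" "f \<in> funs H"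
  shows "norm (f w) \<le> fnorm H f * fnorm H (K w)"
  using Cauchy_Schwarz_fspace[OF assms(2) K_mem[OF assms(1)]] ip_K[OF assms] by simp

lemma fnorm_square_K: "w \<in> X \<Longrightarrow> (fnorm H (K w))\<^sup>2 = Re (k w w)"
  using fnorm_square[OF K_mem] ip_K[OF _ K_mem] by (simp add: kernel_at_def)

lemma mult_op_lin: "mult_op m (\<lambda>x. c * f x + g x) = (\<lambda>x. c * mult_op m f x + mult_op m g x)"
  by (simp add: mult_op_def algebra_simps)

text \<open>In the role of the closed graph theorem. If multiplication by \<open>m\<close> were
  unbounded, adjoint images of normalised kernel combinations would have norms at least
  \<open>4 ^ n\<close>, while pairing any \<open>f\<close> with them stays below the norm of
  \<open>mult_op m f\<close>; \<open>weakly_bounded_not_exponential\<close> excludes this.\<close>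

lemma mult_op_bounded:
  assumes m: "\<And>f. f \<in> funs H \<Longrightarrow> mult_op m f \<in> funs H"
  shows "\<exists>C. \<forall>f\<in>funs H. fnorm H (mult_op m f) \<le> C * fnorm H f"
proof (rule ccontr)
  assume unbounded: "\<nexists>C. \<forall>f\<in>funs H. fnorm H (mult_op m f) \<le> C * fnorm H f"
  have "\<exists>g\<in>funs H. 4 ^ n \<le> fnorm H g \<and> (\<forall>f\<in>funs H. norm (ip H f g) \<le> fnorm H (mult_op m f))"
    for n :: nat
  proof -
    obtain f where f: "f \<in> funs H" "4 ^ n * fnorm H f < fnorm H (mult_op m f)"
      using unbounded by (meson not_le)
    \<comment> \<open>Otherwise \<open>4 ^ n * fnorm H f\<close> would bound the functional of
      \<open>mult_op m f\<close> on kernel combinations, and hence its norm.\<close>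
    have "\<exists>W c. finite W \<and> W \<subseteq> X \<and>
      4 ^ n * fnorm H f * fnorm H (kernel_comb W c) < norm (\<Sum>w\<in>W. c w * cnj (mult_op m f w))"
    proof (rule ccontr)
      assume no: "\<nexists>W c. finite W \<and> W \<subseteq> X \<and>
        4 ^ n * fnorm H f * fnorm H (kernel_comb W c) < norm (\<Sum>w\<in>W. c w * cnj (mult_op m f w))"
      have "fnorm H (mult_op m f) \<le> 4 ^ n * fnorm H f"
        by (rule fnorm_rkhs_le)
          (use no fnorm_nonneg[OF f(1)] mem_outside[OF m[OF f(1)]] in \<open>auto simp: not_less\<close>)
      then show False using f(2) by simp
    qed
    then obtain W c where W: "finite W" "W \<subseteq> X"
      and less: "4 ^ n * fnorm H f * fnorm H (kernel_comb W c) < norm (\<Sum>w\<in>W. c w * cnj (mult_op m f w))"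
      by blast
    define \<gamma> where "\<gamma> = kernel_comb W c"
    \<comment> \<open>What the adjoint of multiplication by \<open>m\<close> does to
      \<open>\<gamma>\<close>, written down explicitly because the existence of the adjoint rests on
      the boundedness being proved.\<close>
    define \<gamma>' where "\<gamma>' = kernel_comb W (\<lambda>w. c w * cnj (m w))"
    have \<gamma>: "\<gamma> \<in> funs H" "\<gamma>' \<in> funs H" using W by (simp_all add: \<gamma>_def \<gamma>'_def kernel_comb_mem)
    have ip': "norm (ip H f' \<gamma>') = norm (ip H (mult_op m f') \<gamma>)" if f': "f' \<in> funs H" for f'
    proof -
      have "ip H \<gamma>' f' = ip H \<gamma> (mult_op m f')"
        unfolding \<gamma>_def \<gamma>'_def using W f' m by (simp add: ip_kernel_comb mult_op_def mult_ac)
      then show ?thesis using \<gamma> f' m by (metis complex_mod_cnj ip_commute)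
    qed
    have less': "4 ^ n * fnorm H f * fnorm H \<gamma> < norm (ip H f \<gamma>')"
      using less ip_kernel_comb[OF W(2) m[OF f(1)], of c] ip'[OF f(1)] \<gamma> f m
      by (metis \<gamma>_def complex_mod_cnj ip_commute)
    have pos: "fnorm H \<gamma> > 0"
    proof (rule ccontr)
      assume "\<not> fnorm H \<gamma> > 0"
      then have "fnorm H \<gamma> = 0" using fnorm_nonneg[OF \<gamma>(1)] by simp
      then show False
        using less' ip'[OF f(1)] Cauchy_Schwarz_fspace[OF m[OF f(1)] \<gamma>(1)] by simp
    qed
    define g where "g = (\<lambda>x. of_real (1 / fnorm H \<gamma>) * \<gamma>' x)"
    have g: "g \<in> funs H" unfolding g_def using \<gamma> mem_scale by blast
    have ipg: "norm (ip H f' g) = norm (ip H f' \<gamma>') / fnorm H \<gamma>" if "f' \<in> funs H" for f'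
      unfolding g_def ip_scale_right[OF \<gamma>(2) that] using pos by (simp add: norm_divide)
    have "norm (ip H f' g) \<le> fnorm H (mult_op m f')" if f': "f' \<in> funs H" for f'
      unfolding ipg[OF f'] ip'[OF f']
      using Cauchy_Schwarz_fspace[OF m[OF f'] \<gamma>(1)] pos by (simp add: field_simps)
    moreover have "4 ^ n \<le> fnorm H g"
    proof -
      have "4 ^ n * fnorm H f < norm (ip H f g)"
        using less' pos unfolding ipg[OF f(1)] by (simp add: field_simps)
      also have "\<dots> \<le> fnorm H g * fnorm H f"
        using Cauchy_Schwarz_fspace[OF f(1) g] by (simp add: mult.commute)
      finally show ?thesis
        using fnorm_nonneg[OF f(1)] by (meson less_imp_le mult_right_less_imp_less)
    qed
    ultimately show ?thesis using g by blast
  qed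
  then obtain g where "\<And>n. g n \<in> funs H" "\<And>n::nat. 4 ^ n \<le> fnorm H (g n)"
    "\<And>n f. f \<in> funs H \<Longrightarrow> norm (ip H f (g n)) \<le> fnorm H (mult_op m f)" by metis
  then show False using weakly_bounded_not_exponential[of g] by blast
qed

end

section \<open>Adjoints of multiplication operators\<close>

context rkhs
begin

lemma
  assumes m: "\<And>f. f \<in> funs H \<Longrightarrow> mult_op m f \<in> funs H" and g: "g \<in> funs H"
  shows adj_mult_mem: "adj H (mult_op m) g \<in> funs H"
    and ip_adj_mult: "f \<in> funs H \<Longrightarrow> ip H f (adj H (mult_op m) g) = ip H (mult_op m f) g"
proof -
  obtain C where C: "\<And>f. f \<in> funs H \<Longrightarrow> fnorm H (mult_op m f) \<le> C * fnorm H f"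
    using mult_op_bounded[OF m] by blast
  show "adj H (mult_op m) g \<in> funs H"
    by (rule adj_mem[of _ C]) (erule m, rule mult_op_lin, erule C, rule g)
  show "f \<in> funs H \<Longrightarrow> ip H f (adj H (mult_op m) g) = ip H (mult_op m f) g"
    by (rule ip_adj[of _ C]) (erule m, rule mult_op_lin, erule C, rule g)
qed

lemma ip_adj_mult_left:
  assumes m: "\<And>f. f \<in> funs H \<Longrightarrow> mult_op m f \<in> funs H" and g: "g \<in> funs H" and f: "f \<in> funs H"
  shows "ip H (adj H (mult_op m) g) f = ip H g (mult_op m f)"
  using ip_adj_mult[OF m g f] ip_commute[OF f adj_mult_mem[OF m g]] ip_commute[OF m[OF f] g] by simp

lemma adj_mult_eval:
  assumes m: "\<And>f. f \<in> funs H \<Longrightarrow> mult_op m f \<in> funs H" and g: "g \<in> funs H" and w: "w \<in> X"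
  shows "adj H (mult_op m) g w = ip H g (mult_op m (K w))"
  using ip_K[OF w adj_mult_mem[OF m g]] ip_adj_mult_left[OF m g K_mem[OF w]] by simp

lemma adj_mult_diff:
  assumes m: "\<And>f. f \<in> funs H \<Longrightarrow> mult_op m f \<in> funs H" and f: "f \<in> funs H" and g: "g \<in> funs H"
  shows "adj H (mult_op m) (\<lambda>x. f x - g x) = (\<lambda>x. adj H (mult_op m) f x - adj H (mult_op m) g x)"
  by (rule rkhs_ext)
    (simp_all add: adj_mult_mem adj_mult_eval m f g mem_diff ip_diff_left K_mem)

text \<open>Each \<open>K w\<close> is an eigenvector of the adjoint, with eigenvalue
  \<open>cnj (m w)\<close>.\<close>

lemma adj_mult_kernel_comb:
  assumes m: "\<And>f. f \<in> funs H \<Longrightarrow> mult_op m f \<in> funs H" and W: "W \<subseteq> X"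
  shows "adj H (mult_op m) (kernel_comb W c) = kernel_comb W (\<lambda>w. c w * cnj (m w))"
proof (rule rkhs_ext)
  fix x assume x: "x \<in> X"
  have "adj H (mult_op m) (kernel_comb W c) x = (\<Sum>w\<in>W. c w * cnj (m w * K x w))"
    using adj_mult_eval[OF m kernel_comb_mem[OF W] x] ip_kernel_comb[OF W m[OF K_mem[OF x]]]
    by (simp add: mult_op_def)
  also have "\<dots> = kernel_comb W (\<lambda>w. c w * cnj (m w)) x"
    unfolding kernel_comb_def using x W kernel_hermitian
    by (intro sum.cong) (auto simp: kernel_at_def)
  finally show "adj H (mult_op m) (kernel_comb W c) x = kernel_comb W (\<lambda>w. c w * cnj (m w)) x" .
qed (use m W kernel_comb_mem adj_mult_mem in auto)

lemma fnorm_adj_mult_le: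
  assumes m: "\<And>f. f \<in> funs H \<Longrightarrow> mult_op m f \<in> funs H"
    and C: "\<And>f. f \<in> funs H \<Longrightarrow> fnorm H (mult_op m f) \<le> C * fnorm H f" and g: "g \<in> funs H"
  shows "fnorm H (adj H (mult_op m) g) \<le> C * fnorm H g"
proof -
  define h where "h = adj H (mult_op m) g"
  have h: "h \<in> funs H" unfolding h_def by (rule adj_mult_mem[OF m g])
  have "(fnorm H h)\<^sup>2 = Re (ip H (mult_op m h) g)"
    using fnorm_square[OF h] ip_adj_mult[OF m g h] by (simp add: h_def)
  also have "\<dots> \<le> fnorm H (mult_op m h) * fnorm H g"
    using Cauchy_Schwarz_fspace[OF m[OF h] g] complex_Re_le_cmod order_trans by blast
  also have "\<dots> \<le> (C * fnorm H h) * fnorm H g"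
    using C[OF h] fnorm_nonneg[OF g] by (intro mult_right_mono) auto
  finally have le: "fnorm H h * fnorm H h \<le> (C * fnorm H g) * fnorm H h"
    by (simp add: power2_eq_square mult_ac)
  show ?thesis
  proof (cases "fnorm H h = 0")
    case True
    have "0 \<le> C * fnorm H g"
      using C[OF g] fnorm_nonneg[OF m[OF g]] by linarith
    then show ?thesis using True by (simp add: h_def)
  next
    case False
    then show ?thesis using le fnorm_nonneg[OF h] unfolding h_def by simp
  qed
qed

text \<open>Moving the adjoints to the other side makes the quadratic form a real difference of
  squared norms; the operator inequality is used in this form from here on.\<close>

lemma op_le_mult_iff:
  assumes a: "\<And>f. f \<in> funs H \<Longrightarrow> mult_op a f \<in> funs H"
    and b: "\<And>f. f \<in> funs H \<Longrightarrow> mult_op b f \<in> funs H"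
  shows "op_le H (\<lambda>f x. adj H (mult_op a) (mult_op a f) x + adj H (mult_op b) (mult_op b f) x) (\<lambda>f. f)
    \<longleftrightarrow> (\<forall>f\<in>funs H. (fnorm H (mult_op a f))\<^sup>2 + (fnorm H (mult_op b f))\<^sup>2 \<le> (fnorm H f)\<^sup>2)"
proof -
  have "ip H (\<lambda>x. f x - (adj H (mult_op a) (mult_op a f) x + adj H (mult_op b) (mult_op b f) x)) f =
      of_real ((fnorm H f)\<^sup>2 - ((fnorm H (mult_op a f))\<^sup>2 + (fnorm H (mult_op b f))\<^sup>2))"
    if f: "f \<in> funs H" for f
    using f by (simp add: ip_diff_left ip_add_left mem_add adj_mult_mem[OF a] adj_mult_mem[OF b] a b
        ip_adj_mult_left[OF a] ip_adj_mult_left[OF b] ip_self)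
  then show ?thesis
    unfolding op_le_def by (simp add: complex_nonneg_Reals_iff)
qed

end

section \<open>Kernels on the unit ball\<close>

lemma norm_herm_le: "norm (herm z w) \<le> norm z * norm w"
proof -
  have "norm (herm z w) \<le> (\<Sum>j\<in>UNIV. norm (z $ j * cnj (w $ j)))"
    unfolding herm_def by (rule norm_sum)
  also have "\<dots> = (\<Sum>j\<in>UNIV. \<bar>norm (z $ j)\<bar> * \<bar>norm (w $ j)\<bar>)"
    by (simp add: norm_mult)
  also have "\<dots> \<le> norm z * norm w"
    unfolding norm_vec_def by (rule L2_set_mult_ineq)
  finally show ?thesis .
qed

lemma herm_ball_neq_1: "z \<in> ball 0 1 \<Longrightarrow> w \<in> ball 0 1 \<Longrightarrow> herm z w \<noteq> 1"
  using norm_herm_le[of z w] mult_strict_mono'[of "norm z" 1 "norm w" 1] by auto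

locale vector_rkhs = rkhs X k H for X :: "(complex ^ 'd) set" and k H

text \<open>Summing over \<open>j\<close> produces the factor \<open>herm v w\<close>, which the
  identity for the kernel absorbs; the two remaining terms are squared moduli of linear functionals.
  The case \<open>b = 0\<close> is the Drury-Arveson kernel, general \<open>b\<close> the kernel of
  \<open>H(b)\<close>.\<close>

lemma (in vector_rkhs) sum_fnorm_square_kernel_comb:
  assumes id: "\<And>v w. v \<in> X \<Longrightarrow> w \<in> X \<Longrightarrow> herm v w * k v w = k v w - 1 + b v * cnj (b w)"
    and W: "W \<subseteq> X"
  shows "(\<Sum>j\<in>UNIV. (fnorm H (kernel_comb W (\<lambda>w. c w * cnj (w $ j))))\<^sup>2) =
    (fnorm H (kernel_comb W c))\<^sup>2 - (norm (sum c W))\<^sup>2 + (norm (\<Sum>w\<in>W. c w * cnj (b w)))\<^sup>2"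
proof -
  let ?S = "\<lambda>y. \<Sum>w\<in>W. \<Sum>v\<in>W. c w * cnj (c v) * y w v"
  have sq: "of_real ((norm (\<Sum>w\<in>W. c w * cnj (f w)))\<^sup>2) = ?S (\<lambda>w v. f v * cnj (f w))" for f
    unfolding complex_norm_square cnj_sum sum_product by (simp add: mult_ac)
  have "of_real (\<Sum>j\<in>UNIV. (fnorm H (kernel_comb W (\<lambda>w. c w * cnj (w $ j))))\<^sup>2) =
      (\<Sum>j\<in>UNIV. ?S (\<lambda>w v. v $ j * cnj (w $ j) * cnj (k w v)))"
    unfolding of_real_sum fnorm_square_kernel_comb[OF W] by (simp add: mult_ac)
  also have "\<dots> = ?S (\<lambda>w v. herm v w * cnj (k w v))"
    unfolding herm_def sum_distrib_left sum_distrib_right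
    by (subst sum.swap, intro sum.cong refl, subst sum.swap, rule refl)
  also have "\<dots> = ?S (\<lambda>w v. cnj (k w v) - 1 * cnj 1 + b v * cnj (b w))"
    by (intro sum.cong refl arg_cong2[where f = "(*)"])
      (simp add: kernel_hermitian id subsetD[OF W])
  also have "\<dots> = ?S (\<lambda>w v. cnj (k w v)) - ?S (\<lambda>w v. 1 * cnj 1) + ?S (\<lambda>w v. b v * cnj (b w))"
    by (simp only: distrib_left right_diff_distrib sum.distrib sum_subtractf)
  also have "\<dots> = of_real ((fnorm H (kernel_comb W c))\<^sup>2 - (norm (sum c W))\<^sup>2 +
      (norm (\<Sum>w\<in>W. c w * cnj (b w)))\<^sup>2)"
    using sq[of "\<lambda>_. 1"]
    by (simp only: of_real_add of_real_diff sq[of b] fnorm_square_kernel_comb[OF W]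
        complex_cnj_one mult_1_right)
  finally show ?thesis by (simp only: of_real_eq_iff)
qed

section \<open>The Drury--Arveson space\<close>

locale drury_arveson =
  fixes H2 :: "(complex ^ 'd) fspace"
  assumes is_drury_arveson: "is_drury_arveson H2"
begin

sublocale vector_rkhs "ball 0 1" "\<lambda>z w. 1 / (1 - herm z w)" H2
  using is_drury_arveson by unfold_locales (simp add: is_drury_arveson_def)

lemma mem_holomorphic: "f \<in> funs H2 \<Longrightarrow> holomorphic_cn_on f (ball 0 1)"
  using is_drury_arveson by (simp add: is_drury_arveson_def)

lemma zero_ball: "0 \<in> ball (0 :: complex ^ 'd) 1" by simp

lemma K0: "K 0 z = (if z \<in> ball 0 1 then 1 else 0)"
  by (simp add: kernel_at_def herm_def)

lemma fnorm_K0: "fnorm H2 (K 0) = 1"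
proof -
  have "(fnorm H2 (K 0))\<^sup>2 = 1" unfolding fnorm_square_K[OF zero_ball] by (simp add: herm_def)
  then show ?thesis using fnorm_nonneg[OF K_mem[OF zero_ball]] by (auto simp: power2_eq_1_iff)
qed

lemma herm_kernel:
  "v \<in> ball 0 1 \<Longrightarrow> w \<in> ball 0 1 \<Longrightarrow> herm v w * (1 / (1 - herm v w)) = 1 / (1 - herm v w) - 1"
  using herm_ball_neq_1[of v w] by (simp add: field_simps)

text \<open>The coefficients \<open>c w * cnj (w $ j)\<close> come from the adjoint of
  multiplication by the \<open>j\<close>-th coordinate, so this is contractivity of the column of
  adjoint shifts, on kernel combinations.\<close>

lemma row_kernel_comb_le:
  assumes "W \<subseteq> ball 0 1"
  shows "(\<Sum>j\<in>UNIV. (fnorm H2 (kernel_comb W (\<lambda>w. c w * cnj (w $ j))))\<^sup>2) \<le> (fnorm H2 (kernel_comb W c))\<^sup>2"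
proof -
  have "(\<Sum>j\<in>UNIV. (fnorm H2 (kernel_comb W (\<lambda>w. c w * cnj (w $ j))))\<^sup>2) =
    (fnorm H2 (kernel_comb W c))\<^sup>2 - (norm (sum c W))\<^sup>2 + (norm (\<Sum>w\<in>W. c w * cnj 0))\<^sup>2"
    by (rule sum_fnorm_square_kernel_comb[OF _ assms]) (simp only: herm_kernel mult_zero_left add_0_right)
  then show ?thesis by simp
qed

text \<open>Dual to \<open>row_kernel_comb_le\<close>: pairing with a kernel combination moves the
  coordinates onto its coefficients, then Cauchy-Schwarz is applied in the space and over
  \<open>j\<close>. So the coordinate multiplications form a row contraction.\<close>

lemma
  assumes fs: "\<And>j. fs j \<in> funs H2"
  shows row_mem: "(\<lambda>z. \<Sum>j\<in>UNIV. z $ j * fs j z) \<in> funs H2"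
    and row_fnorm_le: "(fnorm H2 (\<lambda>z. \<Sum>j\<in>UNIV. z $ j * fs j z))\<^sup>2 \<le> (\<Sum>j\<in>UNIV. (fnorm H2 (fs j))\<^sup>2)"
proof -
  let ?\<phi> = "\<lambda>z. \<Sum>j\<in>UNIV. z $ j * fs j z"
  define M where "M = L2_set (\<lambda>j. fnorm H2 (fs j)) UNIV"
  have M: "0 \<le> M" by (simp add: M_def)
  have zero: "?\<phi> x = 0" if "x \<notin> ball 0 1" for x using mem_outside[OF fs that] by simp
  have bound: "norm (\<Sum>w\<in>W. c w * cnj (?\<phi> w)) \<le> M * fnorm H2 (kernel_comb W c)"
    if W: "finite W" "W \<subseteq> ball 0 1" for W c
  proof -
    let ?G = "\<lambda>j. kernel_comb W (\<lambda>w. c w * cnj (w $ j))"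
    have "(\<Sum>w\<in>W. c w * cnj (?\<phi> w)) = (\<Sum>j\<in>UNIV. \<Sum>w\<in>W. (c w * cnj (w $ j)) * cnj (fs j w))"
      by (subst sum.swap) (simp add: cnj_sum sum_distrib_left mult.assoc)
    also have "norm \<dots> \<le> (\<Sum>j\<in>UNIV. \<bar>fnorm H2 (fs j)\<bar> * \<bar>fnorm H2 (?G j)\<bar>)"
      by (rule order_trans[OF norm_sum sum_mono])
        (use ip_kernel_comb_bound[OF W(2) fs] fnorm_nonneg[OF fs] fnorm_nonneg[OF kernel_comb_mem[OF W(2)]]
          in simp)
    also have "\<dots> \<le> M * L2_set (\<lambda>j. fnorm H2 (?G j)) UNIV"
      unfolding M_def by (rule L2_set_mult_ineq)
    also have "\<dots> \<le> M * fnorm H2 (kernel_comb W c)"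
      unfolding L2_set_def
      by (intro mult_left_mono real_le_lsqrt)
        (use row_kernel_comb_le[OF W(2)] M fnorm_nonneg[OF kernel_comb_mem[OF W(2)]] in \<open>auto intro: sum_nonneg\<close>)
    finally show ?thesis .
  qed
  show "?\<phi> \<in> funs H2" by (rule mem_rkhsI[of _ M]) (erule zero, rule M, erule (1) bound)
  have "fnorm H2 ?\<phi> \<le> M" by (rule fnorm_rkhs_le[of _ M]) (erule zero, rule M, erule (1) bound)
  then have "(fnorm H2 ?\<phi>)\<^sup>2 \<le> M\<^sup>2"
    using fnorm_nonneg[OF \<open>?\<phi> \<in> funs H2\<close>] by (intro power_mono)
  also have "\<dots> = (\<Sum>j\<in>UNIV. (fnorm H2 (fs j))\<^sup>2)"
    by (simp add: M_def L2_set_def sum_nonneg)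
  finally show "(fnorm H2 ?\<phi>)\<^sup>2 \<le> (\<Sum>j\<in>UNIV. (fnorm H2 (fs j))\<^sup>2)" .
qed

lemma coord_mult_mem:
  assumes "f \<in> funs H2"
  shows "mult_op (\<lambda>z. z $ j) f \<in> funs H2"
proof -
  have "(\<lambda>z. \<Sum>i\<in>UNIV. z $ i * (if i = j then f else (\<lambda>x. 0)) z) = mult_op (\<lambda>z. z $ j) f"
    by (auto simp: mult_op_def if_distrib[of "\<lambda>g. g _"] if_distrib[of "(*) _"] cong: if_cong)
  then show ?thesis
    using row_mem[of "\<lambda>i. if i = j then f else (\<lambda>x. 0)"] assms mem_zero by simp
qed

text \<open>The backward shift; in one variable it is \<open>(f z - f 0) / z\<close>.\<close>

definition bshift :: "'d \<Rightarrow> (complex ^ 'd \<Rightarrow> complex) \<Rightarrow> complex ^ 'd \<Rightarrow> complex" where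
  "bshift j = adj H2 (mult_op (\<lambda>z. z $ j))"

lemma bshift_mem: "f \<in> funs H2 \<Longrightarrow> bshift j f \<in> funs H2"
  unfolding bshift_def by (rule adj_mult_mem[OF coord_mult_mem])

text \<open>Inside the ball, pair \<open>f\<close> with the identity
  \<open>K w - K 0 = sum_j cnj (w $ j) * z $ j * K w\<close>, which is \<open>herm_kernel\<close>
  with the factor \<open>herm z w\<close> written out.\<close>

lemma bshift_decomp:
  assumes f: "f \<in> funs H2"
  shows "(\<lambda>z. \<Sum>j\<in>UNIV. z $ j * bshift j f z) = (\<lambda>z. f z - f 0 * K 0 z)"
proof
  fix w
  show "(\<Sum>j\<in>UNIV. w $ j * bshift j f w) = f w - f 0 * K 0 w"
  proof (cases "w \<in> ball 0 1")
    case True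
    have fn: "(\<lambda>z. \<Sum>j\<in>UNIV. cnj (w $ j) * mult_op (\<lambda>z. z $ j) (K w) z) = (\<lambda>z. K w z - K 0 z)"
    proof
      fix z
      show "(\<Sum>j\<in>UNIV. cnj (w $ j) * mult_op (\<lambda>z. z $ j) (K w) z) = K w z - K 0 z"
      proof (cases "z \<in> ball 0 1")
        case z: True
        have "(\<Sum>j\<in>UNIV. cnj (w $ j) * mult_op (\<lambda>z. z $ j) (K w) z) = herm z w * (1 / (1 - herm z w))"
          using z by (simp add: mult_op_def kernel_at_def herm_def sum_divide_distrib mult_ac)
        then show ?thesis using z herm_kernel[OF z True] by (simp add: kernel_at_def herm_def)
      qed (simp add: mult_op_def kernel_at_def)
    qed
    have "(\<Sum>j\<in>UNIV. w $ j * bshift j f w) = (\<Sum>j\<in>UNIV. ip H2 f (\<lambda>z. cnj (w $ j) * mult_op (\<lambda>z. z $ j) (K w) z))"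
      unfolding bshift_def
      by (intro sum.cong refl) (simp only: adj_mult_eval[OF coord_mult_mem f True]
          ip_scale_right[OF coord_mult_mem[OF K_mem[OF True]] f] complex_cnj_cnj)
    also have "\<dots> = ip H2 f (\<lambda>z. \<Sum>j\<in>UNIV. cnj (w $ j) * mult_op (\<lambda>z. z $ j) (K w) z)"
      by (intro ip_sum_right[symmetric] mem_scale coord_mult_mem K_mem f True)
    also have "\<dots> = f w - f 0"
      unfolding fn using True by (simp only: ip_diff_right[OF K_mem K_mem f] zero_ball ip_K f)
    finally show ?thesis using True by (simp add: K0)
  next
    case False
    then show ?thesis using mem_outside[OF f False] mem_outside[OF bshift_mem[OF f] False] by (simp add: K0)
  qed
qed

text \<open>The identity \<open>bshift_decomp\<close>, paired with \<open>f\<close>.\<close>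

lemma bshift_fnorm:
  assumes f: "f \<in> funs H2"
  shows "(\<Sum>j\<in>UNIV. (fnorm H2 (bshift j f))\<^sup>2) = (fnorm H2 f)\<^sup>2 - (norm (f 0))\<^sup>2"
proof -
  have "of_real (\<Sum>j\<in>UNIV. (fnorm H2 (bshift j f))\<^sup>2) =
      (\<Sum>j\<in>UNIV. ip H2 (mult_op (\<lambda>z. z $ j) (bshift j f)) f)"
    unfolding of_real_sum
    by (intro sum.cong refl)
      (metis bshift_def bshift_mem coord_mult_mem f ip_adj_mult ip_self)
  also have "\<dots> = ip H2 (\<lambda>z. \<Sum>j\<in>UNIV. mult_op (\<lambda>z. z $ j) (bshift j f) z) f"
    by (intro ip_sum_left[symmetric] coord_mult_mem bshift_mem f)
  also have "(\<lambda>z. \<Sum>j\<in>UNIV. mult_op (\<lambda>z. z $ j) (bshift j f) z) = (\<lambda>z. f z - f 0 * K 0 z)"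
    unfolding mult_op_def by (rule bshift_decomp[OF f])
  also have "ip H2 (\<lambda>z. f z - f 0 * K 0 z) f = of_real ((fnorm H2 f)\<^sup>2) - of_real ((norm (f 0))\<^sup>2)"
    by (simp only: ip_diff_left[OF f mem_scale f] K_mem zero_ball ip_scale_left f ip_K_left ip_self
        complex_norm_square)
  finally show ?thesis by (simp only: of_real_diff[symmetric] of_real_eq_iff)
qed

end

section \<open>Restriction to slices and lowest Taylor coefficients\<close>

lemma norm_vector_scalar_mult:
  fixes z :: "complex ^ 'd"
  shows "norm (c *s z) = norm c * norm z"
  by (simp add: norm_vec_def norm_mult L2_set_right_distrib)

text \<open>Complex linearity of the derivative \<open>D\<close> makes its restriction to the line
  multiplication by \<open>D z\<close>.\<close>

lemma holomorphic_cn_slice: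
  assumes a: "holomorphic_cn_on a (ball 0 1)" and z: "norm z \<le> 1"
  shows "(\<lambda>t. a (t *s z)) holomorphic_on ball 0 1"
proof (rule holomorphic_onI)
  fix t :: complex assume t: "t \<in> ball 0 1"
  have "norm t * norm z < 1"
    using t z mult_left_mono[OF z, of "norm t"] by simp
  then have "t *s z \<in> ball 0 1" by (simp add: norm_vector_scalar_mult)
  then obtain D where D: "(a has_derivative D) (at (t *s z))" "\<And>c v. D (c *s v) = c * D v"
    using a unfolding holomorphic_cn_on_def by blast
  have "bounded_linear (\<lambda>h. h *s z)"
    by (rule bounded_linear_intro[of _ "norm z"])
      (simp_all add: vector_sadd_rdistrib norm_vector_scalar_mult vec_eq_iff)
  then have "((\<lambda>h. h *s z) has_derivative (\<lambda>h. h *s z)) (at t)"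
    by (rule bounded_linear_imp_has_derivative)
  from has_derivative_compose[OF this D(1)]
  have "((\<lambda>t. a (t *s z)) has_derivative (*) (D z)) (at t)"
    unfolding D(2) by (simp only: mult.commute[of _ "D z"])
  then have "((\<lambda>t. a (t *s z)) has_field_derivative D z) (at t)"
    by (simp add: has_field_derivative_def)
  then show "(\<lambda>t. a (t *s z)) field_differentiable at t within ball 0 1"
    using field_differentiable_at_within field_differentiable_def by blast
qed

context drury_arveson
begin

lemma fnorm_K_le:
  assumes "norm w \<le> 1 / 2"
  shows "fnorm H2 (K w) \<le> 2"
proof -
  have w: "w \<in> ball 0 1" using assms by auto
  have "norm (herm w w) \<le> 1/2 * (1/2)"
    using norm_herm_le[of w w] mult_mono[OF assms assms] by simp
  then have *: "1 / 2 \<le> norm (1 - herm w w)"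
    using norm_triangle_ineq2[of 1 "herm w w"] by simp
  have "(fnorm H2 (K w))\<^sup>2 \<le> norm (1 / (1 - herm w w))"
    unfolding fnorm_square_K[OF w] by (rule complex_Re_le_cmod)
  also have "\<dots> \<le> 2\<^sup>2"
    unfolding norm_divide norm_one using frac_le[OF _ order_refl _ *, of 1] by simp
  finally show ?thesis by (rule power2_le_imp_le) simp
qed

text \<open>
  On a slice where \<open>a\<close> does not vanish identically, with \<open>m\<close> the order of its zero at the origin,
  the \<open>m\<close>-th Taylor coefficient of \<open>a f\<close> is that of \<open>a\<close> times \<open>f 0\<close>.
\<close>

lemma eval_zero_le_mult:
  assumes a: "multiplier H2 a" and w: "w \<in> ball 0 1" "a w \<noteq> 0"
  obtains C where "\<And>f. f \<in> funs H2 \<Longrightarrow> norm (f 0) \<le> C * fnorm H2 (mult_op a f)"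
proof -
  \<comment> \<open>The point \<open>w\<close> is stretched to a point \<open>z\<close> of the
    closed ball. It then sits on the slice through \<open>z\<close> at the parameter
    \<open>1 / r\<close>, inside the open disc.\<close>
  define r where "r = 2 / (1 + norm w)"
  have r: "1 < r" "r * norm w \<le> 1"
    using w by (simp_all add: r_def field_simps add_pos_nonneg)
  define z where "z = of_real r *s w"
  have z: "norm z \<le> 1" using r by (simp add: z_def norm_vector_scalar_mult)
  define \<phi> where "\<phi> t = a (t *s z)" for t
  have \<phi>: "\<phi> holomorphic_on ball 0 1"
    using a z unfolding \<phi>_def multiplier_def by (intro holomorphic_cn_slice) auto
  have nz: "\<phi> (of_real (1 / r)) \<noteq> 0"
    using w r by (simp add: \<phi>_def z_def vector_smult_assoc)
  have in_ball: "of_real (1 / r) \<in> ball (0::complex) 1"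
    using r by (simp add: norm_divide)
  have "\<exists>n. (deriv ^^ n) \<phi> 0 \<noteq> 0"
  proof (rule ccontr)
    assume "\<nexists>n. (deriv ^^ n) \<phi> 0 \<noteq> 0"
    then have "\<phi> (of_real (1 / r)) = 0"
      using in_ball by (intro holomorphic_fun_eq_0_on_connected[OF \<phi>, of 0]) auto
    then show False using nz by blast
  qed
  then obtain m where m: "(deriv ^^ m) \<phi> 0 \<noteq> 0" "\<And>n. n < m \<Longrightarrow> (deriv ^^ n) \<phi> 0 = 0"
    using exists_least_iff[of "\<lambda>n. (deriv ^^ n) \<phi> 0 \<noteq> 0"] by blast
  define p where "p = norm ((deriv ^^ m) \<phi> 0)"
  have p: "p > 0" using m by (simp add: p_def)
  have "norm (f 0) \<le> (fact m * 2 / (1/2) ^ m / p) * fnorm H2 (mult_op a f)" if f: "f \<in> funs H2" for f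
  proof -
    define \<psi> where "\<psi> t = f (t *s z)" for t
    have \<psi>: "\<psi> holomorphic_on ball 0 1"
      unfolding \<psi>_def by (rule holomorphic_cn_slice[OF mem_holomorphic[OF f] z])
    have af: "mult_op a f \<in> funs H2" using a f by (simp add: multiplier_def)
    have "(deriv ^^ m) (\<lambda>t. \<phi> t * \<psi> t) 0 =
        (\<Sum>i = 0..m. of_nat (m choose i) * (deriv ^^ i) \<phi> 0 * (deriv ^^ (m - i)) \<psi> 0)"
      by (rule higher_deriv_mult[OF \<phi> \<psi>]) auto
    also have "\<dots> = (\<Sum>i\<in>{m}. of_nat (m choose i) * (deriv ^^ i) \<phi> 0 * (deriv ^^ (m - i)) \<psi> 0)"
      by (rule sum.mono_neutral_right) (use m(2) in auto)
    also have "\<dots> = (deriv ^^ m) \<phi> 0 * f 0" by (simp add: \<psi>_def)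
    finally have "p * norm (f 0) = norm ((deriv ^^ m) (\<lambda>t. \<phi> t * \<psi> t) 0)"
      by (simp add: p_def norm_mult)
    \<comment> \<open>On the circle of radius 1/2 the slice stays where the kernel functions have
      norm at most 2.\<close>
    also have "\<dots> \<le> fact m * (fnorm H2 (mult_op a f) * 2) / (1/2) ^ m"
    proof (rule Cauchy_inequality)
      have hol: "(\<lambda>t. \<phi> t * \<psi> t) holomorphic_on ball 0 1" by (intro holomorphic_intros \<phi> \<psi>)
      then show "(\<lambda>t. \<phi> t * \<psi> t) holomorphic_on ball 0 (1/2)"
        by (rule holomorphic_on_subset) auto
      have "(\<lambda>t. \<phi> t * \<psi> t) holomorphic_on cball 0 (1/2)"
        using hol by (rule holomorphic_on_subset) auto
      then show "continuous_on (cball 0 (1/2)) (\<lambda>t. \<phi> t * \<psi> t)"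
        by (rule holomorphic_on_imp_continuous_on)
      fix t :: complex assume t: "norm (0 - t) = 1/2"
      then have nt: "norm t = 1/2" by simp
      have tz: "norm (t *s z) \<le> 1/2" unfolding norm_vector_scalar_mult nt using z by simp
      then have "t *s z \<in> ball 0 1" by auto
      from norm_eval_le[OF this af]
      show "norm (\<phi> t * \<psi> t) \<le> fnorm H2 (mult_op a f) * 2"
        using mult_left_mono[OF fnorm_K_le[OF tz] fnorm_nonneg[OF af]]
        by (simp add: \<phi>_def \<psi>_def mult_op_def)
    qed simp
    finally show ?thesis using p by (simp add: field_simps)
  qed
  then show ?thesis using that by blast
qed

end

section \<open>The defect form of a contractive multiplier\<close>

locale contractive_mult = drury_arveson H2 for H2 :: "(complex ^ 'd) fspace" +
  fixes b :: "complex ^ 'd \<Rightarrow> complex"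
  assumes contractive_multiplier: "contractive_multiplier H2 b"
begin

lemma b_mem: "f \<in> funs H2 \<Longrightarrow> mult_op b f \<in> funs H2"
  using contractive_multiplier unfolding contractive_multiplier_def multiplier_def by blast

lemma b_fnorm_le:
  assumes f: "f \<in> funs H2"
  shows "fnorm H2 (mult_op b f) \<le> fnorm H2 f"
proof (cases "fnorm H2 f = 0")
  case True
  then have "f = (\<lambda>x. 0)" using fnorm_eq_0 f by blast
  then show ?thesis by (simp add: mult_op_def)
next
  case False
  then have pos: "fnorm H2 f > 0" using fnorm_nonneg[OF f] by simp
  define g where "g = (\<lambda>x. of_real (1 / fnorm H2 f) * f x)"
  have g: "g \<in> funs H2" "fnorm H2 g \<le> 1"
    unfolding g_def using f pos by (simp_all only: fnorm_scale mem_scale) (simp add: norm_divide)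
  have "ereal (fnorm H2 (mult_op b g)) \<le> op_norm H2 (mult_op b)"
    unfolding op_norm_def using g by (intro SUP_upper) auto
  also have "\<dots> \<le> 1" using contractive_multiplier by (simp add: contractive_multiplier_def)
  finally have "fnorm H2 (mult_op b g) \<le> 1" by simp
  moreover have "mult_op b g = (\<lambda>x. of_real (1 / fnorm H2 f) * mult_op b f x)"
    by (auto simp: g_def mult_op_def)
  ultimately have "norm (of_real (1 / fnorm H2 f) :: complex) * fnorm H2 (mult_op b f) \<le> 1"
    using fnorm_scale[OF b_mem[OF f]] by metis
  then show ?thesis using pos by (simp add: norm_divide)
qed

abbreviation badj :: "(complex ^ 'd \<Rightarrow> complex) \<Rightarrow> complex ^ 'd \<Rightarrow> complex" where
  "badj \<equiv> adj H2 (mult_op b)"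

lemma badj_mem: "g \<in> funs H2 \<Longrightarrow> badj g \<in> funs H2"
  by (rule adj_mult_mem[OF b_mem])

lemma badj_kernel_comb:
  "W \<subseteq> ball 0 1 \<Longrightarrow> badj (kernel_comb W c) = kernel_comb W (\<lambda>w. c w * cnj (b w))"
  by (rule adj_mult_kernel_comb[OF b_mem])

lemma badj_eval_zero: "g \<in> funs H2 \<Longrightarrow> badj g 0 = ip H2 g (mult_op b (K 0))"
  by (rule adj_mult_eval[OF b_mem _ zero_ball])

lemma badj_fnorm_le: "g \<in> funs H2 \<Longrightarrow> fnorm H2 (badj g) \<le> fnorm H2 g"
  using fnorm_adj_mult_le[OF b_mem, of 1 g] b_fnorm_le by simp

text \<open>With \<open>b_badj_fnorm\<close>, this compares the two defects: as squares are
  nonnegative, the adjoint's defect at \<open>mult_op b f\<close> is at most the defect at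
  \<open>f\<close>, and the defect at \<open>badj g\<close> is at most the adjoint's defect at
  \<open>g\<close>.\<close>

lemma badj_b_fnorm:
  assumes "f \<in> funs H2"
  shows "(fnorm H2 (\<lambda>x. f x - badj (mult_op b f) x))\<^sup>2 =
    (fnorm H2 f)\<^sup>2 - 2 * (fnorm H2 (mult_op b f))\<^sup>2 + (fnorm H2 (badj (mult_op b f)))\<^sup>2"
  using assms by (simp add: fnorm_square_diff badj_mem b_mem ip_adj_mult ip_self)

lemma b_badj_fnorm:
  assumes "g \<in> funs H2"
  shows "(fnorm H2 (\<lambda>x. g x - mult_op b (badj g) x))\<^sup>2 =
    (fnorm H2 g)\<^sup>2 - 2 * (fnorm H2 (badj g))\<^sup>2 + (fnorm H2 (mult_op b (badj g)))\<^sup>2"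
  using assms
  by (simp add: fnorm_square_diff badj_mem b_mem ip_adj_mult_left[symmetric] ip_self)

text \<open>The form \<open>Q\<close> of the overview.\<close>

definition defect :: "(complex ^ 'd \<Rightarrow> complex) \<Rightarrow> real" where
  "defect f = (fnorm H2 f)\<^sup>2 - (fnorm H2 (mult_op b f))\<^sup>2"

lemma ip_kernel_comb_b:
  assumes "W \<subseteq> ball 0 1"
  shows "ip H2 (kernel_comb W c) (mult_op b (K 0)) = (\<Sum>w\<in>W. c w * cnj (b w))"
  using assms unfolding ip_kernel_comb[OF assms b_mem[OF K_mem[OF zero_ball]]]
  by (intro sum.cong) (auto simp: mult_op_def K0)

text \<open>Evaluate \<open>f = (f - badj (mult_op b f)) + badj (mult_op b f)\<close> at the origin.
  The first part has squared norm at most \<open>defect f\<close>; the value of the second is the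
  pairing of \<open>mult_op b f\<close> with \<open>b\<close>, which the hypothesis controls. That
  hypothesis is membership of \<open>b\<close> in \<open>H(b)\<close>, expressed in
  \<open>H2\<close>.\<close>

lemma eval_zero_le_defect:
  assumes M: "0 \<le> M" and le: "\<And>W c. finite W \<Longrightarrow> W \<subseteq> ball 0 1 \<Longrightarrow>
      (norm (\<Sum>w\<in>W. c w * cnj (b w)))\<^sup>2 \<le>
      M * ((fnorm H2 (kernel_comb W c))\<^sup>2 - (fnorm H2 (kernel_comb W (\<lambda>w. c w * cnj (b w))))\<^sup>2)"
    and f: "f \<in> funs H2"
  shows "(norm (f 0))\<^sup>2 \<le> 2 * (1 + M) * defect f"
proof -
  note k0 = K_mem[OF zero_ball]
  \<comment> \<open>The hypothesis passes from kernel combinations to all members by density and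
    continuity.\<close>
  have key: "(norm (ip H2 g (mult_op b (K 0))))\<^sup>2 \<le> M * ((fnorm H2 g)\<^sup>2 - (fnorm H2 (badj g))\<^sup>2)"
    if g: "g \<in> funs H2" for g
  proof -
    obtain W c where W: "\<And>n::nat. finite (W n)" "\<And>n. W n \<subseteq> ball 0 1"
      and lim: "(\<lambda>n. fnorm H2 (\<lambda>x. kernel_comb (W n) (c n) x - g x)) \<longlonglongrightarrow> 0"
      by (rule kernel_comb_approx[OF g]) blast
    let ?G = "\<lambda>n. kernel_comb (W n) (c n)"
    have G: "?G n \<in> funs H2" for n by (rule kernel_comb_mem[OF W(2)])
    have adjlim: "(\<lambda>n. fnorm H2 (\<lambda>x. badj (?G n) x - badj g x)) \<longlonglongrightarrow> 0"
    proof (rule Lim_null_comparison[OF _ lim])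
      show "\<forall>\<^sub>F n in sequentially. norm (fnorm H2 (\<lambda>x. badj (?G n) x - badj g x))
          \<le> fnorm H2 (\<lambda>x. ?G n x - g x)"
        using badj_fnorm_le[OF mem_diff[OF G g]] fnorm_nonneg[OF mem_diff[OF badj_mem[OF G] badj_mem[OF g]]]
        by (simp add: adj_mult_diff[OF b_mem G g])
    qed
    show ?thesis
    proof (rule LIMSEQ_le)
      show "(\<lambda>n. (norm (ip H2 (?G n) (mult_op b (K 0))))\<^sup>2) \<longlonglongrightarrow> (norm (ip H2 g (mult_op b (K 0))))\<^sup>2"
        by (intro tendsto_intros tendsto_ip_left[OF G g b_mem[OF k0] lim])
      show "(\<lambda>n. M * ((fnorm H2 (?G n))\<^sup>2 - (fnorm H2 (badj (?G n)))\<^sup>2))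
          \<longlonglongrightarrow> M * ((fnorm H2 g)\<^sup>2 - (fnorm H2 (badj g))\<^sup>2)"
        by (intro tendsto_intros tendsto_fnorm G g lim badj_mem adjlim)
      have "(norm (ip H2 (?G n) (mult_op b (K 0))))\<^sup>2 \<le> M * ((fnorm H2 (?G n))\<^sup>2 - (fnorm H2 (badj (?G n)))\<^sup>2)"
        for n
        unfolding ip_kernel_comb_b[OF W(2)] badj_kernel_comb[OF W(2)] by (rule le[OF W])
      then show "\<exists>N. \<forall>n\<ge>N. (norm (ip H2 (?G n) (mult_op b (K 0))))\<^sup>2 \<le>
          M * ((fnorm H2 (?G n))\<^sup>2 - (fnorm H2 (badj (?G n)))\<^sup>2)" by blast
    qed
  qed
  let ?g = "mult_op b f" and ?d = "\<lambda>x. f x - badj (mult_op b f) x"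
  have d: "?d \<in> funs H2" by (intro mem_diff f badj_mem b_mem)
  have split: "f 0 = ip H2 ?d (K 0) + ip H2 ?g (mult_op b (K 0))"
    using ip_K[OF zero_ball f]
    by (simp add: ip_diff_left f badj_mem b_mem k0 ip_adj_mult_left[OF b_mem])
  have adj_le: "(fnorm H2 (badj ?g))\<^sup>2 \<le> (fnorm H2 ?g)\<^sup>2"
    using badj_fnorm_le[OF b_mem[OF f]] fnorm_nonneg[OF badj_mem[OF b_mem[OF f]]] by (rule power_mono)
  have 1: "(norm (ip H2 ?d (K 0)))\<^sup>2 \<le> defect f"
  proof -
    have "(norm (ip H2 ?d (K 0)))\<^sup>2 \<le> (fnorm H2 ?d)\<^sup>2"
      using Cauchy_Schwarz_fspace[OF d k0] by (intro power_mono) (simp_all add: fnorm_K0)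
    also have "\<dots> \<le> defect f" unfolding badj_b_fnorm[OF f] defect_def using adj_le by simp
    finally show ?thesis .
  qed
  have "(fnorm H2 ?g)\<^sup>2 - (fnorm H2 (badj ?g))\<^sup>2 \<le> defect f"
    using badj_b_fnorm[OF f] zero_le_power2[of "fnorm H2 ?d"] by (simp add: defect_def)
  then have 2: "(norm (ip H2 ?g (mult_op b (K 0))))\<^sup>2 \<le> M * defect f"
    using key[OF b_mem[OF f]] mult_left_mono[OF _ M] by (meson order_trans)
  have "(norm (f 0))\<^sup>2 \<le> (norm (ip H2 ?d (K 0)) + norm (ip H2 ?g (mult_op b (K 0))))\<^sup>2"
    unfolding split by (intro power_mono norm_triangle_ineq) auto
  also have "\<dots> \<le> 2 * (norm (ip H2 ?d (K 0)))\<^sup>2 + 2 * (norm (ip H2 ?g (mult_op b (K 0))))\<^sup>2"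
    using zero_le_power2[of "norm (ip H2 ?d (K 0)) - norm (ip H2 ?g (mult_op b (K 0)))"]
    by (simp add: power2_sum power2_diff)
  also have "\<dots> \<le> 2 * (1 + M) * defect f" using 1 2 by (simp add: algebra_simps)
  finally show ?thesis .
qed

text \<open>The assumed bound is applied to \<open>badj\<close> of the combination: its value at the
  origin is the sum, and \<open>b_badj_fnorm\<close> bounds its defect.\<close>

lemma norm_kernel_comb_b_le:
  assumes le: "\<And>f. f \<in> funs H2 \<Longrightarrow> (norm (f 0))\<^sup>2 \<le> C * defect f" and C: "0 \<le> C"
    and W: "W \<subseteq> ball 0 1"
  shows "(norm (\<Sum>w\<in>W. c w * cnj (b w)))\<^sup>2 \<le>
    C * ((fnorm H2 (kernel_comb W c))\<^sup>2 - (fnorm H2 (kernel_comb W (\<lambda>w. c w * cnj (b w))))\<^sup>2)"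
proof -
  let ?g = "kernel_comb W c"
  have g: "?g \<in> funs H2" by (rule kernel_comb_mem[OF W])
  have "(\<Sum>w\<in>W. c w * cnj (b w)) = badj ?g 0"
    unfolding ip_kernel_comb_b[OF W, symmetric] badj_eval_zero[OF g] ..
  then have "(norm (\<Sum>w\<in>W. c w * cnj (b w)))\<^sup>2 \<le> C * defect (badj ?g)"
    using le[OF badj_mem[OF g]] by simp
  also have "defect (badj ?g) \<le> (fnorm H2 ?g)\<^sup>2 - (fnorm H2 (badj ?g))\<^sup>2"
    using b_badj_fnorm[OF g] zero_le_power2[of "fnorm H2 (\<lambda>x. ?g x - mult_op b (badj ?g) x)"]
    by (simp add: defect_def)
  finally show ?thesis using C by (simp add: badj_kernel_comb[OF W] mult_left_mono)
qed

end

section \<open>Finite direct sums of a Hilbert space\<close>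

text \<open>Tuples are encoded as functions on index-point pairs, so that Riesz representation for
  function spaces applies to them.\<close>

definition pow_fspace :: "'x fspace \<Rightarrow> ('j::finite \<times> 'x) fspace" where
  "pow_fspace H = \<lparr>funs = {F. \<forall>j. (\<lambda>x. F (j, x)) \<in> funs H},
     ip = (\<lambda>F G. \<Sum>j\<in>UNIV. ip H (\<lambda>x. F (j, x)) (\<lambda>x. G (j, x)))\<rparr>"

context hilbert_fspace
begin

lemma pow_mem: "F \<in> funs (pow_fspace H) \<longleftrightarrow> (\<forall>j. (\<lambda>x. F (j, x)) \<in> funs H)"
  by (simp add: pow_fspace_def)

lemma pow_ip: "ip (pow_fspace H) F G = (\<Sum>j\<in>UNIV. ip H (\<lambda>x. F (j, x)) (\<lambda>x. G (j, x)))"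
  by (simp add: pow_fspace_def)

lemma pow_ip_self:
  "F \<in> funs (pow_fspace H) \<Longrightarrow>
    ip (pow_fspace H) F F = of_real (\<Sum>j\<in>UNIV. (fnorm H (\<lambda>x. F (j, x)))\<^sup>2)"
  unfolding pow_ip of_real_sum by (intro sum.cong refl) (simp only: ip_self pow_mem)

lemma pow_fnorm:
  "F \<in> funs (pow_fspace H) \<Longrightarrow>
    fnorm (pow_fspace H) F = sqrt (\<Sum>j\<in>UNIV. (fnorm H (\<lambda>x. F (j, x)))\<^sup>2)"
  by (simp only: fnorm_def[of "pow_fspace H"] pow_ip_self Re_complex_of_real)

lemma hilbert_pow: "hilbert_fspace (UNIV \<times> X) (pow_fspace H :: ('j::finite \<times> 'x) fspace)"
proof
  let ?P = "pow_fspace H :: ('j \<times> 'x) fspace"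
  show ips: "inner_product_fspace (UNIV \<times> X) ?P"
    unfolding inner_product_fspace_def
  proof (intro conjI ballI allI impI)
    show "f = (\<lambda>x. 0)" if f: "f \<in> funs ?P" "ip ?P f f = 0" for f
    proof -
      have "(\<Sum>j\<in>UNIV. (fnorm H (\<lambda>x. f (j, x)))\<^sup>2) = 0"
        using f pow_ip_self by (metis of_real_eq_0_iff)
      then have "fnorm H (\<lambda>x. f (j, x)) = 0" for j
        by (simp add: sum_nonneg_eq_0_iff)
      then have "(\<lambda>x. f (j, x)) = (\<lambda>x. 0)" for j
        using fnorm_eq_0 f(1) pow_mem by blast
      then show ?thesis by (metis ext surj_pair)
    qed
    show "f x = 0" if "f \<in> funs ?P" "x \<notin> UNIV \<times> X" for f x
      using that mem_outside[of "\<lambda>y. f (fst x, y)" "snd x"] by (cases x) (simp add: pow_mem)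
    show "(\<lambda>x. c * f x + g x) \<in> funs ?P" if "f \<in> funs ?P" "g \<in> funs ?P" for f g c
      using that mem_lin by (simp add: pow_mem)
    show "ip ?P (\<lambda>x. c * f x + g x) h = c * ip ?P f h + ip ?P g h"
      if "f \<in> funs ?P" "g \<in> funs ?P" "h \<in> funs ?P" for f g h c
      using that by (simp add: pow_mem pow_ip ip_lin sum.distrib sum_distrib_left)
    show "ip ?P g f = cnj (ip ?P f g)" if "f \<in> funs ?P" "g \<in> funs ?P" for f g
      unfolding pow_ip cnj_sum using that by (intro sum.cong refl ip_commute) (auto simp: pow_mem)
    show "ip ?P f f \<in> \<real>\<^sub>\<ge>\<^sub>0" if "f \<in> funs ?P" for f
      unfolding pow_ip_self[OF that] complex_nonneg_Reals_iff by (simp add: sum_nonneg)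
    show "(\<lambda>x. 0) \<in> funs ?P" by (simp add: pow_mem mem_zero)
  qed
  show "complete_fspace ?P"
    unfolding complete_fspace_def
  proof (intro allI impI, elim conjE)
    fix F :: "nat \<Rightarrow> 'j \<times> 'x \<Rightarrow> complex"
    assume F: "\<forall>n. F n \<in> funs ?P"
      and cauchy: "\<forall>e>0. \<exists>N. \<forall>m\<ge>N. \<forall>n\<ge>N. fnorm ?P (\<lambda>x. F m x - F n x) < e"
    interpret P: ip_fspace "UNIV \<times> X" ?P by (rule ip_fspace.intro[OF ips])
    have Fj: "(\<lambda>x. F n (j, x)) \<in> funs H" for n j using F by (simp add: pow_mem)
    have le: "fnorm H (\<lambda>x. F m (j, x) - F n (j, x)) \<le> fnorm ?P (\<lambda>x. F m x - F n x)" for m n j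
    proof -
      have "(fnorm H (\<lambda>x. F m (j, x) - F n (j, x)))\<^sup>2 \<le>
          (\<Sum>j\<in>UNIV. (fnorm H (\<lambda>x. F m (j, x) - F n (j, x)))\<^sup>2)"
        by (rule member_le_sum) auto
      then show ?thesis
        using F by (subst pow_fnorm) (auto intro: P.mem_diff real_le_rsqrt)
    qed
    have "\<exists>f\<in>funs H. (\<lambda>n. fnorm H (\<lambda>x. F n (j, x) - f x)) \<longlonglongrightarrow> 0" for j
    proof -
      have "\<exists>N. \<forall>m\<ge>N. \<forall>n\<ge>N. fnorm H (\<lambda>x. F m (j, x) - F n (j, x)) < e" if "e > 0" for e
      proof -
        obtain N where "\<forall>m\<ge>N. \<forall>n\<ge>N. fnorm ?P (\<lambda>x. F m x - F n x) < e" using cauchy \<open>e > 0\<close> by blast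
        then show ?thesis by (intro exI[of _ N] allI impI le_less_trans[OF le]) blast
      qed
      note cauchy_j = this
      show ?thesis
        by (rule Cauchy_limit_fspace[of "\<lambda>n x. F n (j, x)"]) (rule Fj, erule cauchy_j, blast)
    qed
    then have "\<forall>j. \<exists>f. f \<in> funs H \<and> (\<lambda>n. fnorm H (\<lambda>x. F n (j, x) - f x)) \<longlonglongrightarrow> 0" by blast
    from choice[OF this] obtain f where f: "\<And>j. f j \<in> funs H"
      "\<And>j. (\<lambda>n. fnorm H (\<lambda>x. F n (j, x) - f j x)) \<longlonglongrightarrow> 0" by blast
    define h where "h = (\<lambda>(j, x). f j x)"
    have h: "h \<in> funs ?P" using f by (simp add: pow_mem h_def)
    have "(\<lambda>n. sqrt (\<Sum>j\<in>UNIV. (fnorm H (\<lambda>x. F n (j, x) - f j x))\<^sup>2)) \<longlonglongrightarrow> sqrt (\<Sum>j\<in>(UNIV::'j set). 0\<^sup>2)"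
      by (intro tendsto_intros f)
    then have "(\<lambda>n. fnorm ?P (\<lambda>x. F n x - h x)) \<longlonglongrightarrow> 0"
      using F h by (simp add: pow_fnorm P.mem_diff) (simp add: h_def)
    then show "\<exists>f\<in>funs ?P. (\<lambda>n. fnorm ?P (\<lambda>x. F n x - f x)) \<longlonglongrightarrow> 0" using h by blast
  qed
qed

end

section \<open>The de Branges--Rovnyak space\<close>

locale de_branges_rovnyak = contractive_mult H2 b
  for H2 :: "(complex ^ 'd) fspace" and b :: "complex ^ 'd \<Rightarrow> complex" +
  fixes Hb
  assumes is_de_branges_rovnyak: "is_de_branges_rovnyak b Hb"
begin

sublocale B: vector_rkhs "ball 0 1" "\<lambda>z w. (1 - b z * cnj (b w)) / (1 - herm z w)" Hb
  using is_de_branges_rovnyak by unfold_locales (simp add: is_de_branges_rovnyak_def)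

text \<open>The kernel of \<open>H(b)\<close> is the Drury-Arveson kernel minus
  \<open>b z * cnj (b w)\<close> times it, and the factors of \<open>b\<close> go into the
  coefficients.\<close>

lemma fnorm_kernel_comb_b:
  assumes W: "W \<subseteq> ball 0 1"
  shows "(fnorm Hb (B.kernel_comb W c))\<^sup>2 =
    (fnorm H2 (kernel_comb W c))\<^sup>2 - (fnorm H2 (kernel_comb W (\<lambda>w. c w * cnj (b w))))\<^sup>2"
proof -
  have "complex_of_real ((fnorm Hb (B.kernel_comb W c))\<^sup>2) = of_real ((fnorm H2 (kernel_comb W c))\<^sup>2) -
      of_real ((fnorm H2 (kernel_comb W (\<lambda>w. c w * cnj (b w))))\<^sup>2)"
    unfolding fnorm_square_kernel_comb[OF W] B.fnorm_square_kernel_comb[OF W] sum_subtractf[symmetric]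
    by (intro sum.cong refl) (simp add: diff_divide_distrib algebra_simps)
  then show ?thesis by (simp only: of_real_diff[symmetric] of_real_eq_iff)
qed

lemma row_kernel_comb_b:
  assumes W: "W \<subseteq> ball 0 1"
  shows "(\<Sum>j\<in>UNIV. (fnorm Hb (B.kernel_comb W (\<lambda>w. c w * cnj (w $ j))))\<^sup>2) =
    (fnorm Hb (B.kernel_comb W c))\<^sup>2 - (norm (sum c W))\<^sup>2 + (norm (\<Sum>w\<in>W. c w * cnj (b w)))\<^sup>2"
proof (rule B.sum_fnorm_square_kernel_comb[OF _ W])
  fix v w :: "complex ^ 'd" assume "v \<in> ball 0 1" "w \<in> ball 0 1"
  then show "herm v w * ((1 - b v * cnj (b w)) / (1 - herm v w)) =
      (1 - b v * cnj (b w)) / (1 - herm v w) - 1 + b v * cnj (b w)"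
    using herm_ball_neq_1[of v w] by (simp add: field_simps)
qed

text \<open>The tuple writes \<open>\<beta>\<close>, the sum of the \<open>c w * cnj (b w)\<close>,
  as \<open>cnj (b 0) * sum c W\<close> plus pairings in \<open>H(b)\<close>. By Cauchy-Schwarz and
  \<open>row_kernel_comb_b\<close>, \<open>|\<beta>|^2\<close> is at most \<open>t\<close> times
  itself plus the squared norm of the combination in \<open>H(b)\<close>. Since
  \<open>t < 1\<close>, it can be absorbed, which gives the factor
  \<open>t / (1 - t)\<close>.\<close>

lemma strict_tuple_imp_bound:
  assumes bs: "\<And>j. bs j \<in> funs Hb"
    and gleason: "\<And>z. z \<in> ball 0 1 \<Longrightarrow> (\<Sum>j\<in>UNIV. z $ j * bs j z) = b z - b 0"
    and strict: "(\<Sum>j\<in>UNIV. (fnorm Hb (bs j))\<^sup>2) < 1 - (norm (b 0))\<^sup>2"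
  obtains C where "\<And>f. f \<in> funs H2 \<Longrightarrow> (norm (f 0))\<^sup>2 \<le> C * defect f"
proof -
  define s where "s = (\<Sum>j\<in>UNIV. (fnorm Hb (bs j))\<^sup>2)"
  define t where "t = (norm (b 0))\<^sup>2 + s"
  have s: "0 \<le> s" by (simp add: s_def sum_nonneg)
  have t: "0 \<le> t" "t < 1" using s strict by (simp_all add: t_def s_def)
  have le: "(norm (\<Sum>w\<in>W. c w * cnj (b w)))\<^sup>2 \<le> (t / (1 - t)) *
      ((fnorm H2 (kernel_comb W c))\<^sup>2 - (fnorm H2 (kernel_comb W (\<lambda>w. c w * cnj (b w))))\<^sup>2)"
    if W: "finite W" "W \<subseteq> ball 0 1" for W c
  proof -
    let ?G = "\<lambda>j. B.kernel_comb W (\<lambda>w. c w * cnj (w $ j))"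
    define \<beta> where "\<beta> = (\<Sum>w\<in>W. c w * cnj (b w))"
    define S where "S = (\<Sum>j\<in>UNIV. (fnorm Hb (?G j))\<^sup>2)"
    have S: "0 \<le> S" by (simp add: S_def sum_nonneg)
    have "\<beta> = (\<Sum>w\<in>W. cnj (b 0) * c w + (\<Sum>j\<in>UNIV. (c w * cnj (w $ j)) * cnj (bs j w)))"
      unfolding \<beta>_def
    proof (intro sum.cong refl)
      fix w assume "w \<in> W"
      then have "cnj (b w) = cnj (b 0) + (\<Sum>j\<in>UNIV. cnj (w $ j) * cnj (bs j w))"
        using gleason[of w] W by (auto simp: cnj_sum[symmetric] complex_cnj_mult[symmetric]
            complex_cnj_add[symmetric] simp del: complex_cnj_mult complex_cnj_add cnj_sum)
      then show "c w * cnj (b w) = cnj (b 0) * c w + (\<Sum>j\<in>UNIV. (c w * cnj (w $ j)) * cnj (bs j w))"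
        by (simp add: sum_distrib_left algebra_simps)
    qed
    also have "\<dots> = cnj (b 0) * sum c W + (\<Sum>j\<in>UNIV. \<Sum>w\<in>W. (c w * cnj (w $ j)) * cnj (bs j w))"
      by (subst sum.swap) (simp add: sum.distrib sum_distrib_left)
    also have "norm \<dots> \<le> norm (cnj (b 0) * sum c W) +
        (\<Sum>j\<in>UNIV. norm (\<Sum>w\<in>W. (c w * cnj (w $ j)) * cnj (bs j w)))"
      by (rule order_trans[OF norm_triangle_ineq add_left_mono[OF norm_sum]])
    also have "\<dots> \<le> norm (b 0) * norm (sum c W) + (\<Sum>j\<in>UNIV. \<bar>fnorm Hb (bs j)\<bar> * \<bar>fnorm Hb (?G j)\<bar>)"
      using B.ip_kernel_comb_bound[OF W(2) bs] B.fnorm_nonneg[OF bs]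
        B.fnorm_nonneg[OF B.kernel_comb_mem[OF W(2)]]
      by (intro add_mono sum_mono) (simp_all add: norm_mult)
    also have "\<dots> \<le> norm (b 0) * norm (sum c W) + sqrt s * sqrt S"
      using L2_set_mult_ineq[of "\<lambda>j. fnorm Hb (bs j)" "\<lambda>j. fnorm Hb (?G j)" UNIV]
      unfolding L2_set_def s_def S_def by simp
    finally have "(norm \<beta>)\<^sup>2 \<le> (norm (b 0) * norm (sum c W) + sqrt s * sqrt S)\<^sup>2"
      by (intro power_mono) auto
    also have "\<dots> \<le> ((norm (b 0))\<^sup>2 + (sqrt s)\<^sup>2) * ((norm (sum c W))\<^sup>2 + (sqrt S)\<^sup>2)"
    proof -
      have "(x * u + y * v)\<^sup>2 \<le> (x\<^sup>2 + y\<^sup>2) * (u\<^sup>2 + v\<^sup>2)" for x y u v :: real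
        using zero_le_power2[of "x * v - y * u"] by (simp add: power2_eq_square algebra_simps)
      then show ?thesis .
    qed
    also have "\<dots> = t * ((norm (sum c W))\<^sup>2 + S)" using s S by (simp add: t_def)
    also have "\<dots> = t * ((fnorm Hb (B.kernel_comb W c))\<^sup>2 + (norm \<beta>)\<^sup>2)"
      unfolding S_def row_kernel_comb_b[OF W(2)] \<beta>_def by simp
    finally have "(1 - t) * (norm \<beta>)\<^sup>2 \<le> t * (fnorm Hb (B.kernel_comb W c))\<^sup>2"
      by (simp add: algebra_simps)
    then show ?thesis
      using t unfolding fnorm_kernel_comb_b[OF W(2), symmetric] \<beta>_def by (simp add: field_simps)
  qed
  have "(norm (f 0))\<^sup>2 \<le> 2 * (1 + t / (1 - t)) * defect f" if "f \<in> funs H2" for f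
    by (rule eval_zero_le_defect[OF _ le that]) (use t in auto)
  then show ?thesis using that by blast
qed

text \<open>The constant function gives \<open>1 \<le> C * (1 - |b 0|^2)\<close>. The strict
  inequality leaves a positive factor in \<open>gleason_functional_bound\<close>.\<close>

lemma norm_b_zero:
  assumes "\<And>f. f \<in> funs H2 \<Longrightarrow> (norm (f 0))\<^sup>2 \<le> C * defect f"
  shows "0 < C" "(norm (b 0))\<^sup>2 < C / (1 + C)"
proof -
  note k0 = K_mem[OF zero_ball]
  have 1: "1 \<le> C * defect (K 0)" using assms[OF k0] by (simp add: K0)
  have "norm (b 0) \<le> fnorm H2 (mult_op b (K 0))"
    using norm_eval_le[OF zero_ball b_mem[OF k0]] unfolding fnorm_K0 by (simp add: mult_op_def K0)
  then have "(norm (b 0))\<^sup>2 \<le> (fnorm H2 (mult_op b (K 0)))\<^sup>2" by (intro power_mono) auto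
  then have d: "defect (K 0) \<le> 1 - (norm (b 0))\<^sup>2" unfolding defect_def fnorm_K0 by simp
  have d0: "0 \<le> defect (K 0)"
    unfolding defect_def using b_fnorm_le[OF k0] fnorm_nonneg[OF b_mem[OF k0]]
    by (simp add: power_mono)
  show C: "0 < C"
  proof (rule ccontr)
    assume "\<not> 0 < C"
    then have "C * defect (K 0) \<le> 0" using d0 by (intro mult_nonpos_nonneg) auto
    then show False using 1 by simp
  qed
  have "1 \<le> C * (1 - (norm (b 0))\<^sup>2)" using 1 mult_left_mono[OF d, of C] C by linarith
  then have *: "1 + C * (norm (b 0))\<^sup>2 \<le> C * 1" by (simp add: algebra_simps)
  then have "C * (norm (b 0))\<^sup>2 < C * 1" by linarith
  then have "(norm (b 0))\<^sup>2 < 1" using C mult_less_cancel_left_pos by blast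
  with * show "(norm (b 0))\<^sup>2 < C / (1 + C)" using C by (simp add: field_simps)
qed

text \<open>
  Adding a multiple of the evaluation at the origin changes \<open>\<Sum>\<^sub>w c w\<close> but neither side of the
  inequality; the optimal multiple is used.
\<close>

lemma gleason_functional_bound:
  assumes le: "\<And>f. f \<in> funs H2 \<Longrightarrow> (norm (f 0))\<^sup>2 \<le> C * defect f"
    and W: "finite W" "W \<subseteq> ball 0 1"
  shows "(norm (\<Sum>w\<in>W. c w * cnj (b w - b 0)))\<^sup>2 \<le> (C / (1 + C) - (norm (b 0))\<^sup>2) *
    (\<Sum>j\<in>UNIV. (fnorm Hb (B.kernel_comb W (\<lambda>w. c w * cnj (w $ j))))\<^sup>2)"
proof -
  define \<theta> where "\<theta> = C / (1 + C)"
  define p where "p = (norm (b 0))\<^sup>2"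
  have C: "0 < C" and p: "0 \<le> p" "p < \<theta>" using norm_b_zero[OF le] by (auto simp: p_def \<theta>_def)
  \<comment> \<open>If the weights sum to \<open>\<tau>\<close>, the inequality reads
    \<open>|\<delta> + \<tau> * cnj (b 0)|^2 \<le> \<theta> * (S + |\<tau>|^2)\<close>; it is
    sharpest at \<open>\<tau> = b 0 * \<delta> / (\<theta> - p)\<close>.\<close>
  define t where "t = 1 / (\<theta> - p)"
  have t: "t > 0" "t * (\<theta> - p) = 1" using p by (simp_all add: t_def)
  define \<delta> where "\<delta> = (\<Sum>w\<in>W. c w * cnj (b w - b 0))"
  define V where "V = insert 0 W"
  define e where "e w = (if w \<in> W then c w else 0) +
    (if w = 0 then of_real t * b 0 * \<delta> - sum c W else 0)" for w
  have V: "finite V" "V \<subseteq> ball 0 1" "0 \<in> V" using W by (auto simp: V_def)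
  have sum_e: "(\<Sum>w\<in>V. e w * y w) = (\<Sum>w\<in>W. c w * y w) + (of_real t * b 0 * \<delta> - sum c W) * y 0" for y
  proof -
    have "(\<Sum>w\<in>V. (if w \<in> W then c w else 0) * y w) = (\<Sum>w\<in>W. c w * y w)"
      using V(1) by (intro sum.mono_neutral_cong_right) (auto simp: V_def)
    moreover have "(\<Sum>w\<in>V. (if w = 0 then of_real t * b 0 * \<delta> - sum c W else 0) * y w) =
        (of_real t * b 0 * \<delta> - sum c W) * y 0"
      using V by (simp add: if_distrib[of "\<lambda>x. x * _"] cong: if_cong)
    ultimately show ?thesis by (simp only: e_def distrib_right sum.distrib)
  qed
  have sigma: "sum e V = of_real t * b 0 * \<delta>" using sum_e[of "\<lambda>_. 1"] by simp
  have \<delta>: "\<delta> = (\<Sum>w\<in>W. c w * cnj (b w)) - sum c W * cnj (b 0)"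
    by (simp add: \<delta>_def right_diff_distrib sum_subtractf sum_distrib_right)
  have beta: "(\<Sum>w\<in>V. e w * cnj (b w)) = of_real (1 + t * p) * \<delta>"
    unfolding sum_e[of "\<lambda>w. cnj (b w)"] p_def of_real_add of_real_mult complex_norm_square
    using \<delta> by (simp add: algebra_simps)
  \<comment> \<open>The weight at the origin drops out because the origin has zero
    coordinates.\<close>
  have G: "B.kernel_comb V (\<lambda>w. e w * cnj (w $ j)) = B.kernel_comb W (\<lambda>w. c w * cnj (w $ j))" for j
  proof
    fix z
    show "B.kernel_comb V (\<lambda>w. e w * cnj (w $ j)) z = B.kernel_comb W (\<lambda>w. c w * cnj (w $ j)) z"
      unfolding B.kernel_comb_def using sum_e[of "\<lambda>w. cnj (w $ j) * B.K w z"] by (simp add: mult.assoc)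
  qed
  define S where "S = (\<Sum>j\<in>UNIV. (fnorm Hb (B.kernel_comb W (\<lambda>w. c w * cnj (w $ j))))\<^sup>2)"
  have S: "S = (fnorm Hb (B.kernel_comb V e))\<^sup>2 - (norm (sum e V))\<^sup>2 + (norm (\<Sum>w\<in>V. e w * cnj (b w)))\<^sup>2"
    using row_kernel_comb_b[OF V(2), of e] unfolding G S_def .
  \<comment> \<open>By \<open>S\<close> the norm in \<open>H(b)\<close> contains the left-hand side
    negatively; collecting it turns \<open>C\<close> into
    \<open>\<theta> = C / (1 + C)\<close>.\<close>
  have "(norm (\<Sum>w\<in>V. e w * cnj (b w)))\<^sup>2 \<le> C * (fnorm Hb (B.kernel_comb V e))\<^sup>2"
    unfolding fnorm_kernel_comb_b[OF V(2)] using C by (intro norm_kernel_comb_b_le le V) auto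
  then have "(1 + C) * (norm (\<Sum>w\<in>V. e w * cnj (b w)))\<^sup>2 \<le> C * (S + (norm (sum e V))\<^sup>2)"
    unfolding S by (simp add: algebra_simps)
  then have "(norm (\<Sum>w\<in>V. e w * cnj (b w)))\<^sup>2 \<le> \<theta> * (S + (norm (sum e V))\<^sup>2)"
    using C by (simp add: \<theta>_def field_simps)
  moreover have "(norm (\<Sum>w\<in>V. e w * cnj (b w)))\<^sup>2 = (1 + t * p)\<^sup>2 * (norm \<delta>)\<^sup>2"
    unfolding beta norm_mult power_mult_distrib by (simp only: norm_of_real power2_abs)
  moreover have "(norm (sum e V))\<^sup>2 = t\<^sup>2 * p * (norm \<delta>)\<^sup>2"
    unfolding sigma by (simp add: norm_mult power_mult_distrib p_def)
  ultimately have main: "(1 + t * p)\<^sup>2 * (norm \<delta>)\<^sup>2 \<le> \<theta> * (S + t\<^sup>2 * p * (norm \<delta>)\<^sup>2)"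
    by simp
  define n where "n = (norm \<delta>)\<^sup>2"
  have "1 + t * p = \<theta> * t" using t(2) by (simp add: algebra_simps)
  then have "(1 + t * p)\<^sup>2 * n - \<theta> * (t\<^sup>2 * p * n) = \<theta> * t * (t * (\<theta> - p)) * n"
    by (simp add: power2_eq_square algebra_simps)
  also have "\<dots> = \<theta> * (t * n)" unfolding t(2) by simp
  finally have "\<theta> * (t * n) \<le> \<theta> * S" using main unfolding n_def[symmetric] by (simp add: algebra_simps)
  then have "t * n \<le> S" using p by simp
  then have "(\<theta> - p) * (t * n) \<le> (\<theta> - p) * S" using p by (intro mult_left_mono) auto
  moreover have "(\<theta> - p) * (t * n) = n"
    using t(2) by (metis mult.assoc mult.commute mult_1)
  ultimately have "n \<le> (\<theta> - p) * S" by simp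
  then show ?thesis unfolding n_def \<delta>_def S_def \<theta>_def p_def .
qed

text \<open>Riesz representation in the direct sum of copies of \<open>H(b)\<close>: the squared
  norm of the representing tuple is at most \<open>C / (1 + C) - |b 0|^2\<close>, and
  \<open>C / (1 + C) < 1\<close> makes the inequality strict.\<close>

lemma bound_imp_strict_tuple:
  assumes le: "\<And>f. f \<in> funs H2 \<Longrightarrow> (norm (f 0))\<^sup>2 \<le> C * defect f"
  obtains bs where "\<And>j. bs j \<in> funs Hb"
    "\<And>z. z \<in> ball 0 1 \<Longrightarrow> (\<Sum>j\<in>UNIV. z $ j * bs j z) = b z - b 0"
    "(\<Sum>j\<in>UNIV. (fnorm Hb (bs j))\<^sup>2) < 1 - (norm (b 0))\<^sup>2"
proof -
  let ?P = "pow_fspace Hb :: ('d \<times> (complex ^ 'd)) fspace"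
  interpret P: hilbert_fspace "UNIV \<times> ball 0 1" ?P by (rule B.hilbert_pow)
  define M where "M = sqrt (C / (1 + C) - (norm (b 0))\<^sup>2)"
  have C: "0 < C" "(norm (b 0))\<^sup>2 < C / (1 + C)" using norm_b_zero[OF le] by auto
  have M: "0 \<le> M" "M\<^sup>2 = C / (1 + C) - (norm (b 0))\<^sup>2" using C by (simp_all add: M_def)
  \<comment> \<open>Pairing \<open>v w\<close> with a tuple \<open>bs\<close> gives the conjugate of
    \<open>sum_j w $ j * bs j w\<close>, so prescribing these values is condition (i) of
    admissibility.\<close>
  define v where "v w = (\<lambda>(j, x). cnj (w $ j) * B.K w x)" for w :: "complex ^ 'd"
  have vmem: "v w \<in> funs ?P" if "w \<in> ball 0 1" for w
    using that by (simp add: B.pow_mem v_def B.mem_scale B.K_mem)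
  have bound: "norm (\<Sum>w\<in>W. c w * cnj (b w - b 0)) \<le> M * fnorm ?P (\<lambda>x. \<Sum>w\<in>W. c w * v w x)"
    if W: "finite W" "W \<subseteq> ball 0 1" for W c
  proof -
    have mem: "(\<lambda>x. \<Sum>w\<in>W. c w * v w x) \<in> funs ?P"
      by (intro P.mem_sum P.mem_scale vmem) (use W in auto)
    have comp: "(\<lambda>x. \<Sum>w\<in>W. c w * v w (j, x)) = B.kernel_comb W (\<lambda>w. c w * cnj (w $ j))" for j
      by (simp add: v_def B.kernel_comb_def mult.assoc)
    have "(norm (\<Sum>w\<in>W. c w * cnj (b w - b 0)))\<^sup>2 \<le> (M * fnorm ?P (\<lambda>x. \<Sum>w\<in>W. c w * v w x))\<^sup>2"
      using gleason_functional_bound[OF le W, of c]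
      unfolding power_mult_distrib M(2) B.pow_fnorm[OF mem] comp by (simp add: sum_nonneg)
    then show ?thesis
      by (rule power2_le_imp_le) (use M P.fnorm_nonneg[OF mem] in simp)
  qed
  obtain h where h: "h \<in> funs ?P" "\<And>w. w \<in> ball 0 1 \<Longrightarrow> ip ?P (v w) h = cnj (b w - b 0)"
    "fnorm ?P h \<le> M"
    by (rule P.riesz_family[of "ball 0 1" v "\<lambda>w. cnj (b w - b 0)" M])
      (erule vmem, erule (1) bound, rule M(1), blast)
  define bs where "bs j = (\<lambda>x. h (j, x))" for j
  have bs: "bs j \<in> funs Hb" for j using h(1) by (simp add: bs_def B.pow_mem)
  moreover have "(\<Sum>j\<in>UNIV. z $ j * bs j z) = b z - b 0" if z: "z \<in> ball 0 1" for z
  proof -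
    have "cnj (b z - b 0) = (\<Sum>j\<in>UNIV. ip Hb (\<lambda>x. cnj (z $ j) * B.K z x) (bs j))"
      unfolding h(2)[OF z, symmetric] B.pow_ip by (simp add: v_def bs_def)
    also have "\<dots> = cnj (\<Sum>j\<in>UNIV. z $ j * bs j z)"
      unfolding cnj_sum complex_cnj_mult
      by (intro sum.cong refl) (simp only: B.ip_scale_left[OF B.K_mem[OF z] bs] B.ip_K_left[OF z bs])
    finally show ?thesis by (simp only: complex_cnj_cancel_iff)
  qed
  moreover have "(\<Sum>j\<in>UNIV. (fnorm Hb (bs j))\<^sup>2) < 1 - (norm (b 0))\<^sup>2"
  proof -
    have "(\<Sum>j\<in>UNIV. (fnorm Hb (bs j))\<^sup>2) = (fnorm ?P h)\<^sup>2"
      unfolding B.pow_fnorm[OF h(1)] bs_def by (simp add: sum_nonneg)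
    also have "\<dots> \<le> M\<^sup>2" using h(3) P.fnorm_nonneg[OF h(1)] by (rule power_mono)
    also have "\<dots> < 1 - (norm (b 0))\<^sup>2" unfolding M(2) using C by simp
    finally show ?thesis .
  qed
  ultimately show ?thesis using that by blast
qed

end

section \<open>Construction of the multiplier\<close>

lemma (in contractive_mult) defect_nonneg: "f \<in> funs H2 \<Longrightarrow> 0 \<le> defect f"
  unfolding defect_def using b_fnorm_le fnorm_nonneg[OF b_mem] by (simp add: power_mono)

section \<open>The damped form, its minimiser, and division by it\<close>

locale damped_defect = contractive_mult H2 b
  for H2 :: "(complex ^ 'd) fspace" and b :: "complex ^ 'd \<Rightarrow> complex" +
  fixes \<rho> :: real
  assumes \<rho>: "0 \<le> \<rho>" "\<rho> < 1"
begin

text \<open>The same functions under the form \<open>Q_\<rho>\<close> of the overview. As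
  \<open>\<rho> < 1\<close>, its norm is equivalent to that of \<open>H2\<close>, so completeness
  carries over.\<close>

definition Hd :: "(complex ^ 'd) fspace" where
  "Hd = \<lparr>funs = funs H2, ip = (\<lambda>f g. ip H2 f g - of_real \<rho> * ip H2 (mult_op b f) (mult_op b g))\<rparr>"

lemma funs_Hd [simp]: "funs Hd = funs H2"
  by (simp add: Hd_def)

lemma ip_Hd: "ip Hd f g = ip H2 f g - of_real \<rho> * ip H2 (mult_op b f) (mult_op b g)"
  by (simp add: Hd_def)

lemma ip_Hd_self:
  "f \<in> funs H2 \<Longrightarrow> ip Hd f f = of_real ((fnorm H2 f)\<^sup>2 - \<rho> * (fnorm H2 (mult_op b f))\<^sup>2)"
  by (simp add: ip_Hd ip_self b_mem)

lemma damped_ge: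
  assumes f: "f \<in> funs H2"
  shows "(1 - \<rho>) * (fnorm H2 f)\<^sup>2 \<le> (fnorm H2 f)\<^sup>2 - \<rho> * (fnorm H2 (mult_op b f))\<^sup>2"
  using mult_left_mono[OF power_mono[OF b_fnorm_le[OF f] fnorm_nonneg[OF b_mem[OF f]]] \<rho>(1), of 2]
  by (simp add: algebra_simps)

lemma fnorm_square_Hd:
  assumes f: "f \<in> funs H2"
  shows "(fnorm Hd f)\<^sup>2 = (fnorm H2 f)\<^sup>2 - \<rho> * (fnorm H2 (mult_op b f))\<^sup>2"
proof -
  have "0 \<le> (1 - \<rho>) * (fnorm H2 f)\<^sup>2" using \<rho> by simp
  then have "0 \<le> (fnorm H2 f)\<^sup>2 - \<rho> * (fnorm H2 (mult_op b f))\<^sup>2" using damped_ge[OF f] by linarith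
  then show ?thesis unfolding fnorm_def[of Hd] ip_Hd_self[OF f] by simp
qed

lemma fnorm_Hd_ge: "f \<in> funs H2 \<Longrightarrow> (1 - \<rho>) * (fnorm H2 f)\<^sup>2 \<le> (fnorm Hd f)\<^sup>2"
  using damped_ge fnorm_square_Hd by simp

lemma fnorm_Hd_nonneg: "f \<in> funs H2 \<Longrightarrow> 0 \<le> fnorm Hd f"
  unfolding fnorm_def[of Hd] using fnorm_square_Hd ip_Hd_self by (simp add: real_sqrt_ge_zero flip: fnorm_square_Hd)

lemma fnorm_Hd_le:
  assumes f: "f \<in> funs H2"
  shows "fnorm Hd f \<le> fnorm H2 f"
  by (rule power2_le_imp_le) (use fnorm_square_Hd[OF f] \<rho> fnorm_nonneg[OF f] in auto)

lemma fnorm_le_Hd: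
  assumes f: "f \<in> funs H2"
  shows "fnorm H2 f \<le> fnorm Hd f / sqrt (1 - \<rho>)"
proof (rule power2_le_imp_le)
  show "(fnorm H2 f)\<^sup>2 \<le> (fnorm Hd f / sqrt (1 - \<rho>))\<^sup>2"
    using fnorm_Hd_ge[OF f] \<rho> by (simp add: power_divide field_simps)
qed (use fnorm_Hd_nonneg[OF f] \<rho> in simp)

sublocale D: hilbert_fspace "ball 0 1" Hd
proof
  show "inner_product_fspace (ball 0 1) Hd"
    unfolding inner_product_fspace_def funs_Hd
  proof (intro conjI ballI allI impI)
    show "f = (\<lambda>x. 0)" if f: "f \<in> funs H2" "ip Hd f f = 0" for f
    proof -
      have "(fnorm H2 f)\<^sup>2 - \<rho> * (fnorm H2 (mult_op b f))\<^sup>2 = 0"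
        using f ip_Hd_self by (metis of_real_eq_0_iff)
      then have "(1 - \<rho>) * (fnorm H2 f)\<^sup>2 \<le> 0" using damped_ge[OF f(1)] by linarith
      then have "(fnorm H2 f)\<^sup>2 \<le> 0" using \<rho> by (simp add: mult_le_0_iff)
      then show ?thesis using fnorm_eq_0 f(1) by simp
    qed
    show "ip Hd (\<lambda>x. c * f x + g x) h = c * ip Hd f h + ip Hd g h"
      if "f \<in> funs H2" "g \<in> funs H2" "h \<in> funs H2" for f g h c
      using that by (simp only: ip_Hd mult_op_lin ip_lin b_mem) (simp add: algebra_simps)
    show "ip Hd g f = cnj (ip Hd f g)" if "f \<in> funs H2" "g \<in> funs H2" for f g
      using that ip_commute[OF that] ip_commute[OF b_mem b_mem, OF that] by (simp add: ip_Hd)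
    show "ip Hd f f \<in> \<real>\<^sub>\<ge>\<^sub>0" if f: "f \<in> funs H2" for f
      unfolding ip_Hd_self[OF f] fnorm_square_Hd[OF f, symmetric] complex_nonneg_Reals_iff by simp
  qed (auto intro: mem_zero mem_lin dest: mem_outside)
  show "complete_fspace Hd"
    unfolding complete_fspace_def funs_Hd
  proof (intro allI impI, elim conjE)
    fix F :: "nat \<Rightarrow> complex ^ 'd \<Rightarrow> complex"
    assume F: "\<forall>n. F n \<in> funs H2"
      and cauchy: "\<forall>e>0. \<exists>N. \<forall>m\<ge>N. \<forall>n\<ge>N. fnorm Hd (\<lambda>x. F m x - F n x) < e"
    have c: "\<exists>N. \<forall>m\<ge>N. \<forall>n\<ge>N. fnorm H2 (\<lambda>x. F m x - F n x) < e" if e: "e > 0" for e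
    proof -
      have s: "sqrt (1 - \<rho>) > 0" using \<rho> by simp
      obtain N where N: "\<forall>m\<ge>N. \<forall>n\<ge>N. fnorm Hd (\<lambda>x. F m x - F n x) < e * sqrt (1 - \<rho>)"
        using cauchy s e by (meson mult_pos_pos)
      have "fnorm H2 (\<lambda>x. F m x - F n x) < e" if mn: "m \<ge> N" "n \<ge> N" for m n
      proof (rule le_less_trans[OF fnorm_le_Hd])
        show "(\<lambda>x. F m x - F n x) \<in> funs H2" using F mem_diff by blast
        show "fnorm Hd (\<lambda>x. F m x - F n x) / sqrt (1 - \<rho>) < e"
          using N mn s by (simp add: pos_divide_less_eq)
      qed
      then show ?thesis by blast
    qed
    obtain f where f: "f \<in> funs H2" "(\<lambda>n. fnorm H2 (\<lambda>x. F n x - f x)) \<longlonglongrightarrow> 0"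
      by (rule Cauchy_limit_fspace[of F]) (rule F[rule_format], erule c, blast)
    have "(\<lambda>n. fnorm Hd (\<lambda>x. F n x - f x)) \<longlonglongrightarrow> 0"
    proof (rule Lim_null_comparison[OF _ f(2)])
      show "\<forall>\<^sub>F n in sequentially. norm (fnorm Hd (\<lambda>x. F n x - f x)) \<le> fnorm H2 (\<lambda>x. F n x - f x)"
        using F f(1) by (simp add: fnorm_Hd_le fnorm_Hd_nonneg mem_diff)
    qed
    then show "\<exists>f\<in>funs H2. (\<lambda>n. fnorm Hd (\<lambda>x. F n x - f x)) \<longlonglongrightarrow> 0" using f(1) by blast
  qed
qed

lemma norm_eval_le_Hd:
  assumes "w \<in> ball 0 1" "f \<in> funs H2"
  shows "norm (f w) \<le> (fnorm H2 (K w) / sqrt (1 - \<rho>)) * fnorm Hd f"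
  using norm_eval_le[OF assms] mult_right_mono[OF fnorm_le_Hd[OF assms(2)] fnorm_nonneg[OF K_mem[OF assms(1)]]]
  by (simp add: mult.commute)

lemma ex_eval_zero_rep: "\<exists>e\<in>funs H2. \<forall>g\<in>funs H2. ip Hd g e = g 0"
proof -
  define P where "P = {(g, g 0) |g. g \<in> funs H2}"
  define M where "M = fnorm H2 (K 0) / sqrt (1 - \<rho>)"
  have M: "0 \<le> M" using \<rho> by (simp add: M_def fnorm_K0)
  obtain e where "e \<in> funs Hd" "\<And>g l. (g, l) \<in> P \<Longrightarrow> ip Hd g e = l"
  proof (rule D.riesz_graph[of P M])
    show "P \<noteq> {}" using mem_zero by (auto simp: P_def)
    show "0 \<le> M" by (rule M)
    show "norm l \<le> M * fnorm Hd g" if "(g, l) \<in> P" for g l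
      using that norm_eval_le_Hd[OF zero_ball] by (auto simp: P_def M_def)
    show "((\<lambda>x. c * f x + g x), c * s + t) \<in> P" if "(f, s) \<in> P" "(g, t) \<in> P" for f s g t c
      using that mem_lin by (auto simp: P_def)
  qed (auto simp: P_def)
  then show ?thesis by (auto simp: P_def)
qed

definition e where "e = (SOME e. e \<in> funs H2 \<and> (\<forall>g\<in>funs H2. ip Hd g e = g 0))"

lemma e: "e \<in> funs H2" "g \<in> funs H2 \<Longrightarrow> ip Hd g e = g 0"
proof -
  have "\<exists>e. e \<in> funs H2 \<and> (\<forall>g\<in>funs H2. ip Hd g e = g 0)" using ex_eval_zero_rep by blast
  from someI_ex[OF this, folded e_def] show "e \<in> funs H2" "g \<in> funs H2 \<Longrightarrow> ip Hd g e = g 0" by auto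
qed

definition \<kappa> where "\<kappa> = (fnorm Hd e)\<^sup>2"

text \<open>The representer of evaluation at the origin, rescaled to the value 1 there. By
  \<open>split_off_u\<close> it minimises the form among such functions.\<close>

definition u where "u = (\<lambda>z. of_real (1 / \<kappa>) * e z)"

lemma e_zero: "e 0 = of_real \<kappa>"
  using e(2)[OF e(1)] D.ip_self[of e] e(1) by (simp add: \<kappa>_def)

lemma kappa_ge_1: "1 \<le> \<kappa>"
proof -
  have k0: "K 0 \<in> funs H2" by (rule K_mem[OF zero_ball])
  have "1 = norm (ip Hd (K 0) e)" using e(2)[OF k0] by (simp add: K0)
  also have "\<dots> \<le> fnorm Hd (K 0) * fnorm Hd e"
    using D.Cauchy_Schwarz_fspace k0 e(1) by simp
  also have "\<dots> \<le> 1 * fnorm Hd e"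
    using fnorm_Hd_le[OF k0] fnorm_Hd_nonneg[OF e(1)] by (intro mult_right_mono) (simp_all add: fnorm_K0)
  finally show ?thesis unfolding \<kappa>_def by (simp add: one_le_power)
qed

lemma u_mem: "u \<in> funs H2"
  unfolding u_def by (rule mem_scale[OF e(1)])

lemma u_zero: "u 0 = 1"
  using kappa_ge_1 by (simp add: u_def e_zero)

lemma ip_u: "g \<in> funs H2 \<Longrightarrow> ip Hd g u = g 0 / of_real \<kappa>"
  unfolding u_def using D.ip_scale_right[of e g "of_real (1 / \<kappa>)"] e by simp

lemma fnorm_u: "(fnorm Hd u)\<^sup>2 = 1 / \<kappa>"
  using D.fnorm_square[of u] ip_u[OF u_mem] u_mem u_zero by simp

text \<open>By \<open>ip_u\<close>, functions vanishing at the origin are orthogonal to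
  \<open>u\<close>; this is Pythagoras.\<close>

lemma split_off_u:
  assumes f: "f \<in> funs H2"
  shows "(fnorm Hd f)\<^sup>2 = (fnorm Hd (\<lambda>x. f x - f 0 * u x))\<^sup>2 + (norm (f 0))\<^sup>2 / \<kappa>"
proof -
  have "ip Hd f (\<lambda>x. f 0 * u x) = of_real ((norm (f 0))\<^sup>2 / \<kappa>)"
    using D.ip_scale_right[of u f "f 0"] f u_mem ip_u[OF f] complex_norm_square[of "f 0"]
    by (simp add: mult.commute)
  then have "Re (ip Hd f (\<lambda>x. f 0 * u x)) = (norm (f 0))\<^sup>2 / \<kappa>" by simp
  moreover have "(fnorm Hd (\<lambda>x. f 0 * u x))\<^sup>2 = (norm (f 0))\<^sup>2 / \<kappa>"
    using D.fnorm_scale[of u "f 0"] u_mem by (simp add: power_mult_distrib fnorm_u)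
  ultimately show ?thesis
    using D.fnorm_square_diff[of f "\<lambda>x. f 0 * u x"] f mem_scale[OF u_mem] by simp
qed

text \<open>For \<open>g 0 = 0\<close> the shifts preserve the squared norm in \<open>H2\<close>,
  while \<open>b g\<close> is the row applied to the functions \<open>b * bshift j g\<close>, so the
  subtracted term can only grow.\<close>

lemma bshift_fnorm_Hd_le:
  assumes g: "g \<in> funs H2" "g 0 = 0"
  shows "(\<Sum>j\<in>UNIV. (fnorm Hd (bshift j g))\<^sup>2) \<le> (fnorm Hd g)\<^sup>2"
proof -
  have "(\<lambda>z. \<Sum>j\<in>UNIV. z $ j * mult_op b (bshift j g) z) =
      (\<lambda>z. b z * (\<Sum>j\<in>UNIV. z $ j * bshift j g z))"
    by (simp add: mult_op_def sum_distrib_left mult_ac)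
  also have "\<dots> = mult_op b g"
    using fun_cong[OF bshift_decomp[OF g(1)]] g(2) by (simp add: mult_op_def)
  finally have "(fnorm H2 (mult_op b g))\<^sup>2 \<le> (\<Sum>j\<in>UNIV. (fnorm H2 (mult_op b (bshift j g)))\<^sup>2)"
    using row_fnorm_le[of "\<lambda>j. mult_op b (bshift j g)"] b_mem[OF bshift_mem[OF g(1)]] by simp
  then have "\<rho> * (fnorm H2 (mult_op b g))\<^sup>2 \<le> \<rho> * (\<Sum>j\<in>UNIV. (fnorm H2 (mult_op b (bshift j g)))\<^sup>2)"
    using \<rho> by (intro mult_left_mono)
  then show ?thesis
    using bshift_fnorm[OF g(1)] g(2)
    by (simp add: fnorm_square_Hd g(1) bshift_mem sum_subtractf sum_distrib_left)
qed

text \<open>Subtracting \<open>f 0 * u\<close> instead of a constant keeps the remainder orthogonal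
  to \<open>u\<close>, so the losses in \<open>T_fnorm\<close> simply add.\<close>

definition T :: "'d \<Rightarrow> (complex ^ 'd \<Rightarrow> complex) \<Rightarrow> complex ^ 'd \<Rightarrow> complex" where
  "T j f = bshift j (\<lambda>x. f x - f 0 * u x)"

lemma T_mem: "f \<in> funs H2 \<Longrightarrow> T j f \<in> funs H2"
  unfolding T_def by (intro bshift_mem mem_diff mem_scale u_mem)

lemma T_decomp:
  assumes f: "f \<in> funs H2"
  shows "f z = f 0 * u z + (\<Sum>j\<in>UNIV. z $ j * T j f z)"
  using fun_cong[OF bshift_decomp[OF mem_diff[OF f mem_scale[OF u_mem, of "f 0"]]], of z] u_zero
  by (simp add: T_def)

lemma T_fnorm:
  assumes f: "f \<in> funs H2"
  shows "(\<Sum>j\<in>UNIV. (fnorm Hd (T j f))\<^sup>2) + (norm (f 0))\<^sup>2 / \<kappa> \<le> (fnorm Hd f)\<^sup>2"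
  using bshift_fnorm_Hd_le[OF mem_diff[OF f mem_scale[OF u_mem, of "f 0"]]] split_off_u[OF f] u_zero
  by (simp add: T_def)

text \<open>Iterating \<open>f = f 0 u + \<Sum>\<^sub>j z\<^sub>j (T j f)\<close> expands \<open>f / u\<close> into a series, whose partial sums are these.\<close>

primrec quot_approx :: "nat \<Rightarrow> (complex ^ 'd \<Rightarrow> complex) \<Rightarrow> complex ^ 'd \<Rightarrow> complex" where
  "quot_approx 0 = (\<lambda>f z. 0)"
| "quot_approx (Suc n) = (\<lambda>f z. f 0 * K 0 z + (\<Sum>j\<in>UNIV. z $ j * quot_approx n (T j f) z))"

text \<open>The constant term is orthogonal to the row, which vanishes at the origin. The row
  contraction, the induction hypothesis for each \<open>T j f\<close> and \<open>T_fnorm\<close>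
  then reproduce the same bound.\<close>

lemma quot_approx_bound:
  "f \<in> funs H2 \<Longrightarrow> quot_approx n f \<in> funs H2 \<and> (fnorm H2 (quot_approx n f))\<^sup>2 \<le> \<kappa> * (fnorm Hd f)\<^sup>2"
proof (induction n arbitrary: f)
  case 0
  then show ?case using kappa_ge_1 mem_zero fnorm_zero by simp
next
  case (Suc n)
  note f = \<open>f \<in> funs H2\<close>
  define R where "R = (\<lambda>z. \<Sum>j\<in>UNIV. z $ j * quot_approx n (T j f) z)"
  have mem: "quot_approx n (T j f) \<in> funs H2" for j using Suc.IH T_mem[OF f] by blast
  have R: "R \<in> funs H2" unfolding R_def by (rule row_mem[OF mem])
  have c: "(\<lambda>z. f 0 * K 0 z) \<in> funs H2" by (intro mem_scale K_mem zero_ball)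
  have eq: "quot_approx (Suc n) f = (\<lambda>z. f 0 * K 0 z + R z)" by (simp add: R_def)
  have "ip H2 (\<lambda>z. f 0 * K 0 z) R = 0"
    using ip_scale_left[OF K_mem[OF zero_ball] R] ip_K_left[OF zero_ball R] by (simp add: R_def)
  then have "(fnorm H2 (quot_approx (Suc n) f))\<^sup>2 = (norm (f 0))\<^sup>2 + (fnorm H2 R)\<^sup>2"
    unfolding eq fnorm_square_add[OF c R] fnorm_scale[OF K_mem[OF zero_ball]] fnorm_K0 by simp
  also have "(fnorm H2 R)\<^sup>2 \<le> (\<Sum>j\<in>UNIV. (fnorm H2 (quot_approx n (T j f)))\<^sup>2)"
    unfolding R_def by (rule row_fnorm_le[OF mem])
  also have "\<dots> \<le> (\<Sum>j\<in>UNIV. \<kappa> * (fnorm Hd (T j f))\<^sup>2)"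
    using Suc.IH T_mem[OF f] by (intro sum_mono) blast
  also have "(norm (f 0))\<^sup>2 + \<dots> = \<kappa> * ((\<Sum>j\<in>UNIV. (fnorm Hd (T j f))\<^sup>2) + (norm (f 0))\<^sup>2 / \<kappa>)"
    using kappa_ge_1 by (simp add: sum_distrib_left algebra_simps)
  also have "\<dots> \<le> \<kappa> * (fnorm Hd f)\<^sup>2" using T_fnorm[OF f] kappa_ge_1 by (intro mult_left_mono) auto
  finally show ?case using mem_add[OF c R] unfolding eq by simp
qed

text \<open>Each expansion step carries the error over to the \<open>T j f\<close>. Cauchy-Schwarz
  over the coordinates contributes \<open>(norm z)^2\<close>, and by \<open>T_fnorm\<close> the
  total norm does not grow.\<close>

lemma quot_approx_error:
  assumes z: "z \<in> ball 0 1"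
  shows "f \<in> funs H2 \<Longrightarrow> (norm (f z - u z * quot_approx n f z))\<^sup>2 \<le>
    ((norm z)\<^sup>2) ^ n * ((fnorm H2 (K z) / sqrt (1 - \<rho>))\<^sup>2 * (fnorm Hd f)\<^sup>2)"
proof (induction n arbitrary: f)
  case 0
  then have "(norm (f z))\<^sup>2 \<le> ((fnorm H2 (K z) / sqrt (1 - \<rho>)) * fnorm Hd f)\<^sup>2"
    using norm_eval_le_Hd[OF z] by (intro power_mono) auto
  then show ?case unfolding power_mult_distrib by simp
next
  case (Suc n)
  note f = \<open>f \<in> funs H2\<close>
  define c where "c = (fnorm H2 (K z) / sqrt (1 - \<rho>))\<^sup>2"
  let ?r = "\<lambda>j. T j f z - u z * quot_approx n (T j f) z"
  have eq: "f z - u z * quot_approx (Suc n) f z = (\<Sum>j\<in>UNIV. z $ j * ?r j)"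
    using z by (subst T_decomp[OF f, of z])
      (simp add: K0 algebra_simps sum_subtractf sum_distrib_left)
  have "norm (f z - u z * quot_approx (Suc n) f z) \<le> (\<Sum>j\<in>UNIV. norm (z $ j * ?r j))"
    unfolding eq by (rule norm_sum)
  also have "\<dots> = (\<Sum>j\<in>UNIV. \<bar>norm (z $ j)\<bar> * \<bar>norm (?r j)\<bar>)" by (simp add: norm_mult)
  also have "\<dots> \<le> norm z * L2_set (\<lambda>j. norm (?r j)) UNIV"
    unfolding norm_vec_def by (rule L2_set_mult_ineq)
  finally have "(norm (f z - u z * quot_approx (Suc n) f z))\<^sup>2 \<le> (norm z * L2_set (\<lambda>j. norm (?r j)) UNIV)\<^sup>2"
    by (intro power_mono) auto
  also have "\<dots> = (norm z)\<^sup>2 * (\<Sum>j\<in>UNIV. (norm (?r j))\<^sup>2)"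
    by (simp add: power_mult_distrib L2_set_def sum_nonneg)
  also have "\<dots> \<le> (norm z)\<^sup>2 * (\<Sum>j\<in>UNIV. ((norm z)\<^sup>2) ^ n * (c * (fnorm Hd (T j f))\<^sup>2))"
    unfolding c_def by (intro mult_left_mono sum_mono Suc.IH T_mem f) auto
  also have "\<dots> = ((norm z)\<^sup>2) ^ Suc n * (c * (\<Sum>j\<in>UNIV. (fnorm Hd (T j f))\<^sup>2))"
    by (simp add: sum_distrib_left mult_ac)
  also have "\<dots> \<le> ((norm z)\<^sup>2) ^ Suc n * (c * (fnorm Hd f)\<^sup>2)"
  proof (intro mult_left_mono)
    have "0 \<le> (norm (f 0))\<^sup>2 / \<kappa>" using kappa_ge_1 by simp
    then show "(\<Sum>j\<in>UNIV. (fnorm Hd (T j f))\<^sup>2) \<le> (fnorm Hd f)\<^sup>2" using T_fnorm[OF f] by linarith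
  qed (auto simp: c_def)
  finally show ?case unfolding c_def .
qed

lemma quot_approx_limit:
  assumes z: "z \<in> ball 0 1" and f: "f \<in> funs H2"
  shows "(\<lambda>n. u z * quot_approx n f z) \<longlonglongrightarrow> f z"
proof -
  define c where "c = (fnorm H2 (K z) / sqrt (1 - \<rho>))\<^sup>2 * (fnorm Hd f)\<^sup>2"
  have "(norm z)\<^sup>2 < 1" using z by (simp add: power_less_one_iff abs_square_less_1)
  then have "(\<lambda>n. ((norm z)\<^sup>2) ^ n) \<longlonglongrightarrow> 0" by (rule LIMSEQ_realpow_zero[OF zero_le_power2])
  then have "(\<lambda>n. ((norm z)\<^sup>2) ^ n * c) \<longlonglongrightarrow> 0 * c" by (rule tendsto_mult[OF _ tendsto_const])
  then have "(\<lambda>n. sqrt (((norm z)\<^sup>2) ^ n * c)) \<longlonglongrightarrow> sqrt (0 * c)" by (rule tendsto_real_sqrt)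
  then have lim: "(\<lambda>n. sqrt (((norm z)\<^sup>2) ^ n * c)) \<longlonglongrightarrow> 0" by simp
  have "(\<lambda>n. f z - u z * quot_approx n f z) \<longlonglongrightarrow> 0"
    by (rule Lim_null_comparison[OF _ lim])
      (use quot_approx_error[OF z f] in \<open>auto simp: c_def intro!: always_eventually real_le_rsqrt\<close>)
  from tendsto_diff[OF tendsto_const this, of "f z"] show ?thesis by simp
qed

text \<open>At a zero of \<open>u\<close> the approximations of the constant function would be 0,
  yet they tend to 1.\<close>

lemma u_nonzero:
  assumes z: "z \<in> ball 0 1"
  shows "u z \<noteq> 0"
proof
  assume "u z = 0"
  then have "(\<lambda>n. 0) \<longlonglongrightarrow> K 0 z" using quot_approx_limit[OF z K_mem[OF zero_ball]] by simp
  then have "0 = K 0 z" by (simp only: LIMSEQ_const_iff)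
  then show False using z by (simp add: K0)
qed

text \<open>The \<open>quot_approx n f\<close> are bounded uniformly in \<open>n\<close> and tend
  pointwise to the quotient.\<close>

lemma
  assumes f: "f \<in> funs H2"
  shows div_u_mem: "(\<lambda>z. f z / u z) \<in> funs H2"
    and div_u_fnorm: "fnorm H2 (\<lambda>z. f z / u z) \<le> sqrt (\<kappa> * (fnorm Hd f)\<^sup>2)"
proof -
  have mem: "quot_approx n f \<in> funs H2" for n using quot_approx_bound[OF f] by blast
  have le: "fnorm H2 (quot_approx n f) \<le> sqrt (\<kappa> * (fnorm Hd f)\<^sup>2)" for n
    using quot_approx_bound[OF f] by (intro real_le_rsqrt) blast
  have lim: "(\<lambda>n. quot_approx n f z) \<longlonglongrightarrow> f z / u z" if z: "z \<in> ball 0 1" for z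
    using tendsto_divide[OF quot_approx_limit[OF z f] tendsto_const u_nonzero[OF z]] u_nonzero[OF z] by simp
  have zero: "f z / u z = 0" if "z \<notin> ball 0 1" for z using mem_outside[OF f that] by simp
  show "(\<lambda>z. f z / u z) \<in> funs H2"
    by (rule pointwise_limit_mem[OF mem le tendsto_const]) (erule lim, erule zero)
  show "fnorm H2 (\<lambda>z. f z / u z) \<le> sqrt (\<kappa> * (fnorm Hd f)\<^sup>2)"
    by (rule pointwise_limit_fnorm[OF mem le tendsto_const]) (erule lim, erule zero)
qed

end

section \<open>Removing the damping\<close>

context contractive_mult
begin

text \<open>The squared norm of \<open>Hd\<close>, stated outside its locale so that different
  \<open>\<rho>\<close> can be compared.\<close>

definition damped :: "real \<Rightarrow> (complex ^ 'd \<Rightarrow> complex) \<Rightarrow> real" where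
  "damped \<rho> f = (fnorm H2 f)\<^sup>2 - \<rho> * (fnorm H2 (mult_op b f))\<^sup>2"

text \<open>Gathers the facts for one \<open>\<rho>\<close> in existential form, so that minimisers
  can be chosen along a sequence.\<close>

lemma damped_minimizer:
  assumes "0 \<le> \<rho>" "\<rho> < 1"
  shows "\<exists>\<kappa> u. 1 \<le> \<kappa> \<and> u \<in> funs H2 \<and> u 0 = 1 \<and> damped \<rho> u = 1 / \<kappa> \<and>
    (\<forall>g\<in>funs H2. g 0 = 1 \<longrightarrow> damped \<rho> (\<lambda>x. g x - u x) = damped \<rho> g - 1 / \<kappa>) \<and>
    (\<forall>z\<in>ball 0 1. u z \<noteq> 0) \<and>
    (\<forall>f\<in>funs H2. (\<lambda>z. f z / u z) \<in> funs H2 \<and> fnorm H2 (\<lambda>z. f z / u z) \<le> sqrt (\<kappa> * damped \<rho> f))"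
proof -
  interpret D: damped_defect H2 b \<rho> by unfold_locales (rule assms)+
  have q: "damped \<rho> f = (fnorm D.Hd f)\<^sup>2" if "f \<in> funs H2" for f
    unfolding damped_def by (rule D.fnorm_square_Hd[OF that, symmetric])
  show ?thesis
  proof (intro exI conjI ballI impI)
    show "damped \<rho> D.u = 1 / D.\<kappa>" using q D.u_mem D.fnorm_u by simp
    show "damped \<rho> (\<lambda>x. g x - D.u x) = damped \<rho> g - 1 / D.\<kappa>" if "g \<in> funs H2" "g 0 = 1" for g
      using D.split_off_u[OF that(1)] that D.u_mem mem_diff by (simp add: q)
    show "fnorm H2 (\<lambda>z. f z / D.u z) \<le> sqrt (D.\<kappa> * damped \<rho> f)" if "f \<in> funs H2" for f
      using D.div_u_fnorm[OF that] q[OF that] by simp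
  qed (use D.kappa_ge_1 D.u_mem D.u_zero D.u_nonzero D.div_u_mem in auto)
qed

lemma bound_imp_multiplier:
  assumes le: "\<And>f. f \<in> funs H2 \<Longrightarrow> (norm (f 0))\<^sup>2 \<le> C * defect f"
  obtains a where "multiplier H2 a" "a 0 \<noteq> 0"
    "\<And>f. f \<in> funs H2 \<Longrightarrow> (fnorm H2 (mult_op a f))\<^sup>2 \<le> defect f"
proof -
  note k0 = K_mem[OF zero_ball]
  define \<rho> where "\<rho> n = 1 - 1 / real (Suc n)" for n
  have \<rho>: "0 \<le> \<rho> n" "\<rho> n < 1" for n by (simp_all add: \<rho>_def)
  have \<rho>_mono: "\<rho> m \<le> \<rho> n" if "m \<le> n" for m n
    using that by (simp add: \<rho>_def frac_le)
  have \<rho>_lim: "\<rho> \<longlonglongrightarrow> 1"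
    unfolding \<rho>_def using tendsto_diff[OF tendsto_const LIMSEQ_inverse_real_of_nat, of 1]
    by (simp add: divide_inverse)
  have "\<forall>n. \<exists>\<kappa> u. 1 \<le> \<kappa> \<and> u \<in> funs H2 \<and> u 0 = 1 \<and> damped (\<rho> n) u = 1 / \<kappa> \<and>
    (\<forall>g\<in>funs H2. g 0 = 1 \<longrightarrow> damped (\<rho> n) (\<lambda>x. g x - u x) = damped (\<rho> n) g - 1 / \<kappa>) \<and>
    (\<forall>z\<in>ball 0 1. u z \<noteq> 0) \<and>
    (\<forall>f\<in>funs H2. (\<lambda>z. f z / u z) \<in> funs H2 \<and>
      fnorm H2 (\<lambda>z. f z / u z) \<le> sqrt (\<kappa> * damped (\<rho> n) f))"
    by (rule allI, rule damped_minimizer[OF \<rho>])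
  from this[unfolded choice_iff] obtain \<kappa> u where \<kappa>: "\<And>n. 1 \<le> \<kappa> n" and u: "\<And>n. u n \<in> funs H2" "\<And>n. u n 0 = 1"
    and q_u: "\<And>n. damped (\<rho> n) (u n) = 1 / \<kappa> n"
    and q_diff: "\<And>n g. g \<in> funs H2 \<Longrightarrow> g 0 = 1 \<Longrightarrow>
      damped (\<rho> n) (\<lambda>x. g x - u n x) = damped (\<rho> n) g - 1 / \<kappa> n"
    and u_nz: "\<And>n z. z \<in> ball 0 1 \<Longrightarrow> u n z \<noteq> 0"
    and quot: "\<And>n f. f \<in> funs H2 \<Longrightarrow> (\<lambda>z. f z / u n z) \<in> funs H2"
    and quot_le: "\<And>n f. f \<in> funs H2 \<Longrightarrow> fnorm H2 (\<lambda>z. f z / u n z) \<le> sqrt (\<kappa> n * damped (\<rho> n) f)"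
    by blast
  have defect_le: "defect f \<le> damped (\<rho> n) f" for n f
    using mult_right_mono[of "\<rho> n" 1 "(fnorm H2 (mult_op b f))\<^sup>2"] \<rho>(2)[of n]
    by (simp add: defect_def damped_def)
  have q_nonneg: "0 \<le> damped (\<rho> n) f" if "f \<in> funs H2" for n f
    using defect_le defect_nonneg[OF that] by (rule order_trans[rotated])
  have q_mono: "damped (\<rho> n) f \<le> damped (\<rho> m) f" if "m \<le> n" for m n f
    unfolding damped_def using mult_right_mono[OF \<rho>_mono[OF that], of "(fnorm H2 (mult_op b f))\<^sup>2"] by simp
  have q_one: "damped (\<rho> n) (K 0) \<le> 1" for n
    unfolding damped_def fnorm_K0 using \<rho>(1)[of n] by simp
  \<comment> \<open>The minima of the damped forms. They decrease as \<open>\<rho> n\<close> grows,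
    and the assumed bound on evaluation keeps them above \<open>1 / C\<close>.\<close>
  define y where "y n = 1 / \<kappa> n" for n
  have y: "0 < y n" "y n \<le> 1" for n using \<kappa>[of n] by (simp_all add: y_def)
  have C_pos: "0 < C"
  proof (rule ccontr)
    assume "\<not> 0 < C"
    then have "C * defect (u 0) \<le> 0" using defect_nonneg[OF u(1)] by (intro mult_nonpos_nonneg) auto
    then show False using le[OF u(1)[of 0]] u(2)[of 0] by simp
  qed
  have \<kappa>_le: "\<kappa> n \<le> C" for n
  proof -
    have "1 \<le> C * damped (\<rho> n) (u n)"
    proof (rule order_trans)
      show "1 \<le> C * defect (u n)" using le[OF u(1)[of n]] u(2)[of n] by simp
    qed (use defect_le C_pos in simp)
    then show ?thesis using \<kappa>[of n] by (simp add: q_u field_simps)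
  qed
  \<comment> \<open>The earlier minimiser \<open>u m\<close> competes in the \<open>n\<close>-th
    problem; its excess over the minimum is the form of \<open>u m - u n\<close>.\<close>
  have y_diff: "damped (\<rho> n) (\<lambda>x. u m x - u n x) \<le> y m - y n" if "m \<le> n" for m n
    using q_diff[OF u, of n m] q_mono[OF that, of "u m"] by (simp add: q_u y_def)
  have "y n \<le> y m" if "m \<le> n" for m n
    using y_diff[OF that] q_nonneg[OF mem_diff[OF u(1) u(1)], of n m n] by linarith
  then have "decseq y" by (simp add: decseq_def)
  then obtain Y where Y: "y \<longlonglongrightarrow> Y"
    using y(1) decseq_convergent[of y 0] by (meson less_imp_le)
  have "1 / C \<le> y n" for n using \<kappa>_le[of n] \<kappa>[of n] C_pos by (simp add: y_def frac_le)
  then have "1 / C \<le> Y" using Y LIMSEQ_le_const by blast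
  then have Y_pos: "0 < Y" using C_pos by (metis zero_less_divide_1_iff less_le_trans)
  \<comment> \<open>The difference is, up to sign, \<open>(u m - u n) / u n\<close> times
    \<open>1 / u m\<close>. Both are quotients by a minimiser, hence bounded through
    \<open>quot_le\<close>: the first by \<open>y_diff\<close>, the second by the constant
    function.\<close>
  have close: "norm (1 / u m z - 1 / u n z) \<le> C * (fnorm H2 (K z))\<^sup>2 * sqrt \<bar>y m - y n\<bar>"
    if z: "z \<in> ball 0 1" and mn: "m \<le> n" for m n z
  proof -
    let ?k = "fnorm H2 (K z)"
    have k: "0 \<le> ?k" by (rule fnorm_nonneg[OF K_mem[OF z]])
    have d: "(\<lambda>x. u m x - u n x) \<in> funs H2" by (intro mem_diff u)
    have "norm ((u m z - u n z) / u n z) \<le> fnorm H2 (\<lambda>x. (u m x - u n x) / u n x) * ?k"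
      by (rule norm_eval_le[OF z quot[OF d]])
    also have "\<dots> \<le> sqrt (C * \<bar>y m - y n\<bar>) * ?k"
    proof (rule mult_right_mono[OF order_trans[OF quot_le[OF d]] k])
      show "sqrt (\<kappa> n * damped (\<rho> n) (\<lambda>x. u m x - u n x)) \<le> sqrt (C * \<bar>y m - y n\<bar>)"
        using \<kappa>_le[of n] C_pos y_diff[OF mn] q_nonneg[OF d, of n]
        by (intro real_sqrt_le_mono mult_mono) auto
    qed
    finally have 1: "norm ((u m z - u n z) / u n z) \<le> sqrt (C * \<bar>y m - y n\<bar>) * ?k" .
    have "norm (K 0 z / u m z) \<le> fnorm H2 (\<lambda>x. K 0 x / u m x) * ?k"
      by (rule norm_eval_le[OF z quot[OF k0]])
    also have "\<dots> \<le> sqrt C * ?k"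
    proof (rule mult_right_mono[OF order_trans[OF quot_le[OF k0]] k])
      have "\<kappa> m * damped (\<rho> m) (K 0) \<le> C * 1"
        using \<kappa>_le[of m] C_pos q_one[of m] q_nonneg[OF k0, of m] by (intro mult_mono) auto
      then show "sqrt (\<kappa> m * damped (\<rho> m) (K 0)) \<le> sqrt C" by simp
    qed
    finally have 2: "norm (1 / u m z) \<le> sqrt C * ?k" using z by (simp add: K0)
    have "1 / u m z - 1 / u n z = - ((u m z - u n z) / u n z * (1 / u m z))"
      using u_nz[OF z] by (simp add: field_simps)
    then have "norm (1 / u m z - 1 / u n z) = norm ((u m z - u n z) / u n z) * norm (1 / u m z)"
      by (simp only: norm_minus_cancel norm_mult)
    also have "\<dots> \<le> (sqrt (C * \<bar>y m - y n\<bar>) * ?k) * (sqrt C * ?k)"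
      using k C_pos by (intro mult_mono 1 2) auto
    also have "\<dots> = C * ?k\<^sup>2 * sqrt \<bar>y m - y n\<bar>"
      using C_pos by (simp add: real_sqrt_mult power2_eq_square mult_ac)
    finally show ?thesis .
  qed
  have "convergent (\<lambda>n. 1 / u n z)" if z: "z \<in> ball 0 1" for z
  proof -
    \<comment> \<open>The summand 1 makes \<open>L\<close> positive, so that one can divide by
      it.\<close>
    define L where "L = C * (fnorm H2 (K z))\<^sup>2 + 1"
    have L: "L > 0" using C_pos by (simp add: L_def add_nonneg_pos)
    have close': "norm (1 / u m z - 1 / u n z) \<le> L * sqrt \<bar>y m - y n\<bar>" for m n
    proof -
      have "norm (1 / u m z - 1 / u n z) \<le> C * (fnorm H2 (K z))\<^sup>2 * sqrt \<bar>y m - y n\<bar>"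
      proof (cases "m \<le> n")
        case False
        then show ?thesis using close[OF z, of n m] by (simp add: norm_minus_commute abs_minus_commute)
      qed (rule close[OF z])
      also have "\<dots> \<le> L * sqrt \<bar>y m - y n\<bar>" by (simp add: L_def mult_right_mono)
      finally show ?thesis .
    qed
    have "Cauchy (\<lambda>n. 1 / u n z)"
    proof (rule metric_CauchyI)
      fix e :: real assume e: "0 < e"
      then have "0 < (e / L)\<^sup>2" using L by simp
      then obtain N where N: "\<And>m n. m \<ge> N \<Longrightarrow> n \<ge> N \<Longrightarrow> dist (y m) (y n) < (e / L)\<^sup>2"
        using metric_CauchyD[OF LIMSEQ_imp_Cauchy[OF Y]] by blast
      have "dist (1 / u m z) (1 / u n z) < e" if "m \<ge> N" "n \<ge> N" for m n
      proof -
        have "sqrt \<bar>y m - y n\<bar> < e / L"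
          using N[OF that] e L by (intro real_less_lsqrt) (auto simp: dist_real_def)
        then have "L * sqrt \<bar>y m - y n\<bar> < e" using L by (simp add: pos_less_divide_eq mult.commute)
        then show ?thesis using close'[of m n] by (simp add: dist_norm)
      qed
      then show "\<exists>N. \<forall>m\<ge>N. \<forall>n\<ge>N. dist (1 / u m z) (1 / u n z) < e" by blast
    qed
    then show ?thesis by (rule Cauchy_convergent)
  qed
  then have A: "(\<lambda>n. 1 / u n z) \<longlonglongrightarrow> lim (\<lambda>n. 1 / u n z)" if "z \<in> ball 0 1" for z
    using that convergent_LIMSEQ_iff by blast
  \<comment> \<open>The pointwise limit of \<open>1 / (sqrt \<kappa> u)\<close>. The value 0 off the
    ball makes \<open>a\<close> equal to \<open>mult_op a (K 0)\<close>, hence a member of the space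
    and holomorphic.\<close>
  define a where "a z = (if z \<in> ball 0 1 then of_real (sqrt Y) * lim (\<lambda>n. 1 / u n z) else 0)" for z
  have limit: "mult_op a f \<in> funs H2 \<and> fnorm H2 (mult_op a f) \<le> sqrt (defect f)" if f: "f \<in> funs H2" for f
  proof -
    \<comment> \<open>Products of \<open>f\<close> with the multipliers found for
      \<open>\<rho> n\<close>.\<close>
    define F where "F n = (\<lambda>z. of_real (sqrt (y n)) * (f z / u n z))" for n
    have F: "F n \<in> funs H2" for n unfolding F_def by (intro mem_scale quot f)
    have F_le: "fnorm H2 (F n) \<le> sqrt (damped (\<rho> n) f)" for n
    proof -
      have "fnorm H2 (F n) = sqrt (y n) * fnorm H2 (\<lambda>z. f z / u n z)"
        unfolding F_def fnorm_scale[OF quot[OF f]] using y[of n] by simp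
      also have "\<dots> \<le> sqrt (y n) * sqrt (\<kappa> n * damped (\<rho> n) f)"
        using y[of n] by (intro mult_left_mono quot_le f) auto
      also have "\<dots> = sqrt (damped (\<rho> n) f)"
        using \<kappa>[of n] unfolding real_sqrt_mult[symmetric] by (simp add: y_def)
      finally show ?thesis .
    qed
    have "(\<lambda>n. damped (\<rho> n) f) \<longlonglongrightarrow> (fnorm H2 f)\<^sup>2 - 1 * (fnorm H2 (mult_op b f))\<^sup>2"
      unfolding damped_def by (intro tendsto_intros \<rho>_lim)
    then have lim_q: "(\<lambda>n. sqrt (damped (\<rho> n) f)) \<longlonglongrightarrow> sqrt (defect f)"
      unfolding defect_def by (intro tendsto_real_sqrt) simp
    have lim_F: "(\<lambda>n. F n z) \<longlonglongrightarrow> mult_op a f z" if z: "z \<in> ball 0 1" for z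
    proof -
      have "(\<lambda>n. of_real (sqrt (y n)) * (f z * (1 / u n z))) \<longlonglongrightarrow>
          of_real (sqrt Y) * (f z * lim (\<lambda>n. 1 / u n z))"
        by (intro tendsto_mult tendsto_of_real tendsto_real_sqrt Y tendsto_const A z)
      then show ?thesis using z by (simp add: F_def a_def mult_op_def mult_ac)
    qed
    have zero: "mult_op a f z = 0" if "z \<notin> ball 0 1" for z
      using mem_outside[OF f that] by (simp add: mult_op_def)
    show ?thesis
    proof
      show "mult_op a f \<in> funs H2"
        by (rule pointwise_limit_mem[OF F F_le lim_q]) (erule lim_F, erule zero)
      show "fnorm H2 (mult_op a f) \<le> sqrt (defect f)"
        by (rule pointwise_limit_fnorm[OF F F_le lim_q]) (erule lim_F, erule zero)
    qed
  qed
  have "mult_op a (K 0) = a" by (auto simp: mult_op_def K0 a_def)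
  then have "a \<in> funs H2" using limit[OF k0] by simp
  then have "multiplier H2 a" using limit mem_holomorphic unfolding multiplier_def by blast
  \<comment> \<open>All \<open>u n\<close> are 1 at the origin, so \<open>a 0\<close> is
    \<open>sqrt Y\<close>, positive by the lower bound \<open>1 / C\<close>.\<close>
  moreover have "a 0 \<noteq> 0" using Y_pos by (simp add: a_def u(2) limI)
  moreover have "(fnorm H2 (mult_op a f))\<^sup>2 \<le> defect f" if f: "f \<in> funs H2" for f
    using limit[OF f] fnorm_nonneg[of "mult_op a f"] defect_nonneg[OF f]
    by (metis power_mono real_sqrt_pow2)
  ultimately show ?thesis using that by blast
qed

lemma multiplier_imp_bound:
  assumes a: "multiplier H2 a" "w \<in> ball 0 1" "a w \<noteq> 0"
    and le: "\<And>f. f \<in> funs H2 \<Longrightarrow> (fnorm H2 (mult_op a f))\<^sup>2 \<le> defect f"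
  obtains C where "\<And>f. f \<in> funs H2 \<Longrightarrow> (norm (f 0))\<^sup>2 \<le> C * defect f"
proof -
  obtain C where C: "\<And>f. f \<in> funs H2 \<Longrightarrow> norm (f 0) \<le> C * fnorm H2 (mult_op a f)"
    by (rule eval_zero_le_mult[OF a]) blast
  have "(norm (f 0))\<^sup>2 \<le> C\<^sup>2 * defect f" if f: "f \<in> funs H2" for f
  proof -
    have "(norm (f 0))\<^sup>2 \<le> (C * fnorm H2 (mult_op a f))\<^sup>2" using C[OF f] by (intro power_mono) auto
    also have "\<dots> \<le> C\<^sup>2 * defect f"
      unfolding power_mult_distrib using le[OF f] by (intro mult_left_mono) auto
    finally show ?thesis .
  qed
  then show ?thesis using that by blast
qed

end

section \<open>The characterisation of quasi-extreme multipliers\<close>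

theorem theorem1p1:
  fixes H2 Hb :: "(complex ^ 'd) fspace"
    and b :: "complex ^ 'd \<Rightarrow> complex"
  assumes "is_drury_arveson H2"
    and "contractive_multiplier H2 b"
    and "is_de_branges_rovnyak b Hb"
  shows "quasi_extreme Hb b \<longleftrightarrow>
    (\<forall>a. multiplier H2 a \<and>
         op_le H2
           (\<lambda>f x. adj H2 (mult_op a) (mult_op a f) x + adj H2 (mult_op b) (mult_op b f) x)
           (\<lambda>f. f)
       \<longrightarrow> (\<forall>z\<in>ball 0 1. a z = 0))"
proof -
  interpret de_branges_rovnyak H2 b Hb
    using assms by unfold_locales
  have op_le_iff: "op_le H2
      (\<lambda>f x. adj H2 (mult_op a) (mult_op a f) x + adj H2 (mult_op b) (mult_op b f) x) (\<lambda>f. f) \<longleftrightarrow>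
      (\<forall>f\<in>funs H2. (fnorm H2 (mult_op a f))\<^sup>2 \<le> defect f)" if "multiplier H2 a" for a
    using that by (subst op_le_mult_iff) (auto simp: multiplier_def b_mem defect_def algebra_simps)
  show ?thesis
  proof (intro iffI allI impI ballI)
    fix a z
    assume qe: "quasi_extreme Hb b" and z: "z \<in> ball (0 :: complex ^ 'd) 1"
      and a: "multiplier H2 a \<and> op_le H2
        (\<lambda>f x. adj H2 (mult_op a) (mult_op a f) x + adj H2 (mult_op b) (mult_op b f) x) (\<lambda>f. f)"
    show "a z = 0"
    proof (rule ccontr)
      assume nz: "a z \<noteq> 0"
      have le: "(fnorm H2 (mult_op a f))\<^sup>2 \<le> defect f" if "f \<in> funs H2" for f
        using a op_le_iff[of a] that by blast
      obtain C where C: "\<And>f. f \<in> funs H2 \<Longrightarrow> (norm (f 0))\<^sup>2 \<le> C * defect f"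
        by (rule multiplier_imp_bound[OF conjunct1[OF a] z nz le]) blast+
      obtain bs where "\<And>j. bs j \<in> funs Hb"
        "\<And>z. z \<in> ball 0 1 \<Longrightarrow> (\<Sum>j\<in>UNIV. z $ j * bs j z) = b z - b 0"
        and strict: "(\<Sum>j\<in>UNIV. (fnorm Hb (bs j))\<^sup>2) < 1 - (norm (b 0))\<^sup>2"
        by (rule bound_imp_strict_tuple[of C]) (erule C, blast)
      then have "admissible Hb b bs" by (simp add: admissible_def)
      then show False using qe strict unfolding quasi_extreme_def by force
    qed
  next
    assume only_zero: "\<forall>a. multiplier H2 a \<and> op_le H2
        (\<lambda>f x. adj H2 (mult_op a) (mult_op a f) x + adj H2 (mult_op b) (mult_op b f) x) (\<lambda>f. f)
      \<longrightarrow> (\<forall>z\<in>ball 0 1. a z = 0)"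
    show "quasi_extreme Hb b"
    proof (rule ccontr)
      assume "\<not> quasi_extreme Hb b"
      then obtain bs where bs: "admissible Hb b bs"
        and neq: "(\<Sum>j\<in>UNIV. (fnorm Hb (bs j))\<^sup>2) \<noteq> 1 - (norm (b 0))\<^sup>2"
        unfolding quasi_extreme_def by blast
      have mem: "bs j \<in> funs Hb" for j using bs by (simp add: admissible_def)
      have gleason: "(\<Sum>j\<in>UNIV. z $ j * bs j z) = b z - b 0" if "z \<in> ball 0 1" for z
        using bs that by (simp add: admissible_def)
      have strict: "(\<Sum>j\<in>UNIV. (fnorm Hb (bs j))\<^sup>2) < 1 - (norm (b 0))\<^sup>2"
        using bs neq by (simp add: admissible_def)
      obtain C where C: "\<And>f. f \<in> funs H2 \<Longrightarrow> (norm (f 0))\<^sup>2 \<le> C * defect f"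
        by (rule strict_tuple_imp_bound[of bs]) (rule mem, erule gleason, rule strict, blast)
      obtain a where a: "multiplier H2 a" "a 0 \<noteq> 0"
        "\<And>f. f \<in> funs H2 \<Longrightarrow> (fnorm H2 (mult_op a f))\<^sup>2 \<le> defect f"
        by (rule bound_imp_multiplier[of C]) (erule C, blast)
      then show False using only_zero op_le_iff[OF a(1)] zero_ball by blast
    qed
  qed
qed

end
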